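(* Let $q$ be a prime power, $n$ a positive integer, and $r$ a square-free divisor of $q^n-1$. Then \[ \left|\mathrm{CN}_q^r(n) - \theta(r)\,\mathrm{CN}_q(n)\right| \leq q^{n/2}\, W(r)\, W_{l_1}(F_{l_1}')\cdots W_{l_k}(F_{l_k}')\,\theta(r)\,\theta(\mathbf{q}). \]
   Context: For a divisor $l$ of $n$, $x\in\mathbb{F}_{q^n}$ is normal over $\mathbb{F}_{q^l}$ if $\{x, x^{q^l},\ldots,x^{q^{l(n/l-1)}}\}$ is an $\mathbb{F}_{q^l}$-basis of $\mathbb{F}_{q^n}$; $x$ is completely normal over $\mathbb{F}_q$ if it is normal over $\mathbb{F}_{q^l}$ for every positive divisor $l$ of $n$. For $r\mid q^n-1$, $x\in\mathbb{F}_{q^n}$ is $r$-free if $x=y^d$ with $d\mid r$ and $y\in\mathbb{F}_{q^n}$ implies $d=1$. $\mathrm{CN}_q(n)$ is the number of elements of $\mathbb{F}_{q^n}$ completely normal over $\mathbb{F}_q$, and $\mathrm{CN}_q^r(n)$ is the number of $r$-free elements of $\mathbb{F}_{q^n}$ completely normal over $\mathbb{F}_q$. $\theta(r)=\phi(r)/r$ with $\phi$ Euler's function, and $W(r)$ is the number of positive divisors of $r$. Let $1=l_1<\cdots<l_k<n$ be the proper positive divisors of $n$. For each $i$, $F_{l_i}'$ is the square-free part (product of distinct monic irreducible factors) of $X^{n/l_i}-1$ in $\mathbb{F}_{q^{l_i}}[X]$; $W_{l_i}(F_{l_i}')$ is the number of monic divisors of $F_{l_i}'$ in $\mathbb{F}_{q^{l_i}}[X]$;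 $\phi_{l_i}(F)$ denotes the number of units of $\mathbb{F}_{q^{l_i}}[X]/(F)$; $\theta_{l_i}(X^{n/l_i}-1)=\phi_{l_i}(F_{l_i}')/q^{l_i\deg F_{l_i}'}$; and $\theta(\mathbf{q})=\prod_{i=1}^k\theta_{l_i}(X^{n/l_i}-1)$. *)

theory Defs
  imports
    Complex_Main
    "HOL-Algebra.Polynomial_Divisibility"
    "HOL-Number_Theory.Totient"
    "HOL-Number_Theory.Prime_Powers"
    "HOL-Computational_Algebra.Squarefree"
begin

text \<open>
  Throughout, \<open>R\<close> plays the role of the field with \<open>q ^ n\<close> elements.
\<close>

subsection \<open>Completely normal and free elements\<close>

text \<open>The field with \<open>q ^ l\<close> elements, inside \<open>R\<close>; such a subfield exists and is unique if \<open>l dvd n\<close>.\<close>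

definition GFsub :: "('a, 'b) ring_scheme \<Rightarrow> nat \<Rightarrow> nat \<Rightarrow> 'a set"
  where "GFsub R q l = (THE K. subfield K R \<and> card K = q ^ l)"

definition conjugates :: "('a, 'b) ring_scheme \<Rightarrow> nat \<Rightarrow> nat \<Rightarrow> nat \<Rightarrow> 'a \<Rightarrow> 'a list"
  where "conjugates R q n l x = map (\<lambda>i. x [^]\<^bsub>R\<^esub> (q ^ (l * i))) [0..<n div l]"

definition normal_over :: "('a, 'b) ring_scheme \<Rightarrow> nat \<Rightarrow> nat \<Rightarrow> nat \<Rightarrow> 'a \<Rightarrow> bool"
  where "normal_over R q n l x \<longleftrightarrow>
    ring.independent R (GFsub R q l) (conjugates R q n l x) \<and>
    ring.Span R (GFsub R q l) (conjugates R q n l x) = carrier R"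

definition completely_normal :: "('a, 'b) ring_scheme \<Rightarrow> nat \<Rightarrow> nat \<Rightarrow> 'a \<Rightarrow> bool"
  where "completely_normal R q n x \<longleftrightarrow> (\<forall>l. l dvd n \<longrightarrow> normal_over R q n l x)"

definition r_free :: "('a, 'b) ring_scheme \<Rightarrow> nat \<Rightarrow> 'a \<Rightarrow> bool"
  where "r_free R r x \<longleftrightarrow>
    (\<forall>d::nat. \<forall>y\<in>carrier R. d dvd r \<and> x = y [^]\<^bsub>R\<^esub> d \<longrightarrow> d = 1)"

definition CN :: "('a, 'b) ring_scheme \<Rightarrow> nat \<Rightarrow> nat \<Rightarrow> nat"
  where "CN R q n = card {x \<in> carrier R. completely_normal R q n x}"

definition CN_free :: "('a, 'b) ring_scheme \<Rightarrow> nat \<Rightarrow> nat \<Rightarrow> nat \<Rightarrow> nat"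
  where "CN_free R q n r = card {x \<in> carrier R. r_free R r x \<and> completely_normal R q n x}"

subsection \<open>Arithmetic functions on integers\<close>

definition theta :: "nat \<Rightarrow> real"
  where "theta r = real (totient r) / real r"

definition W :: "nat \<Rightarrow> nat"
  where "W r = card {d. d dvd r}"

subsection \<open>Arithmetic functions on polynomials over a subfield\<close>

text \<open>
  Polynomials in \<open>K[X]\<^bsub>R\<^esub>\<close> are coefficient lists with the leading coefficient first; the
  zero polynomial is \<open>[]\<close>.
\<close>

definition monic_in :: "('a, 'b) ring_scheme \<Rightarrow> 'a set \<Rightarrow> 'a list \<Rightarrow> bool"
  where "monic_in R K p \<longleftrightarrow>
    p \<in> carrier (K[X]\<^bsub>R\<^esub>) \<and> p \<noteq> [] \<and> Polynomials.lead_coeff p = \<one>\<^bsub>R\<^esub>"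

definition X_pow_minus_1 :: "('a, 'b) ring_scheme \<Rightarrow> 'a set \<Rightarrow> nat \<Rightarrow> 'a list"
  where "X_pow_minus_1 R K m = (X\<^bsub>R\<^esub> [^]\<^bsub>K[X]\<^bsub>R\<^esub>\<^esub> m) \<ominus>\<^bsub>K[X]\<^bsub>R\<^esub>\<^esub> \<one>\<^bsub>K[X]\<^bsub>R\<^esub>\<^esub>"

definition sqfree_part :: "('a, 'b) ring_scheme \<Rightarrow> 'a set \<Rightarrow> 'a list \<Rightarrow> 'a list"
  where "sqfree_part R K F =
    finprod (K[X]\<^bsub>R\<^esub>) (\<lambda>P. P)
      {P. monic_in R K P \<and> pirreducible\<^bsub>R\<^esub> K P \<and> P divides\<^bsub>K[X]\<^bsub>R\<^esub>\<^esub> F}"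

definition W_poly :: "('a, 'b) ring_scheme \<Rightarrow> 'a set \<Rightarrow> 'a list \<Rightarrow> nat"
  where "W_poly R K F = card {D. monic_in R K D \<and> D divides\<^bsub>K[X]\<^bsub>R\<^esub>\<^esub> F}"

text \<open>\<open>Rupt\<^bsub>R\<^esub> K F\<close> is the quotient ring of \<open>K[X]\<^bsub>R\<^esub>\<close> by the principal ideal of \<open>F\<close>.\<close>

definition phi_poly :: "('a, 'b) ring_scheme \<Rightarrow> 'a set \<Rightarrow> 'a list \<Rightarrow> nat"
  where "phi_poly R K F = card (Units (Rupt\<^bsub>R\<^esub> K F))"

definition F_sqfree :: "('a, 'b) ring_scheme \<Rightarrow> nat \<Rightarrow> nat \<Rightarrow> nat \<Rightarrow> 'a list"
  where "F_sqfree R q n l =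
    sqfree_part R (GFsub R q l) (X_pow_minus_1 R (GFsub R q l) (n div l))"

definition theta_l :: "('a, 'b) ring_scheme \<Rightarrow> nat \<Rightarrow> nat \<Rightarrow> nat \<Rightarrow> real"
  where "theta_l R q n l =
    real (phi_poly R (GFsub R q l) (F_sqfree R q n l)) /
    real q ^ (l * Polynomials.degree (F_sqfree R q n l))"

definition proper_divisors :: "nat \<Rightarrow> nat set"
  where "proper_divisors n = {l. l dvd n \<and> l < n}"

definition theta_q :: "('a, 'b) ring_scheme \<Rightarrow> nat \<Rightarrow> nat \<Rightarrow> real"
  where "theta_q R q n = (\<Prod>l\<in>proper_divisors n. theta_l R q n l)"

end

theory Submission
  imports Defs "HOL-Algebra.Multiplicative_Group" "HOL-Algebra.Chinese_Remainder"
begin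

text \<open>
  Call the sum of the absolute values of the Fourier coefficients of a function on a finite abelian
  group its Fourier norm; it is submultiplicative. The indicator function of the complement of a
  subgroup of index \<open>h\<close> has Fourier norm \<open>2 (1 - 1/h)\<close>. On the multiplicative group of the field,
  \<open>r\<close>-freeness is the product of these indicators for the subgroups of \<open>p\<close>-th powers, \<open>p\<close> a prime
  divisor of \<open>r\<close>, so its Fourier norm is at most \<open>W(r) \<theta>(r)\<close>. On the additive group, normality over
  the field with \<open>q^l\<close> elements is the product of these indicators for the kernels of
  \<open>((X^m - 1)/P)(\<sigma>)\<close>, where \<open>m = n/l\<close>, \<open>\<sigma>\<close> is the Frobenius map \<open>x \<mapsto> x^(q^l)\<close> and \<open>P\<close> runs over the
  monic irreducible divisors of \<open>X^m - 1\<close>; these kernels have index at most \<open>q^(l deg P)\<close>, so the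
  Fourier norm is at most \<open>W_l(F'_l) \<theta>_l\<close>. The mean of the \<open>r\<close>-free indicator over the nonzero elements
  is \<open>\<theta>(r)\<close>. Subtracting it removes the trivial multiplicative character, and what remains is a
  combination of Gauss sums, each of absolute value at most \<open>q^(n/2)\<close>.
\<close>

section \<open>Characters of finite abelian groups\<close>

text \<open>The obstacle is that normality conditions over different fields interact, and no evident
  formula gives \<open>CN R q n\<close>. Fourier norms avoid the need for one: submultiplicativity
  combines the conditions however they depend on each other, and the count stays as an unevaluated
  factor of the main term. For the same reason inequalities suffice for the indices, for the numbers
  of divisors and for the numbers of units. The constant 2 (1 - 1/h) is 1 - 1/h for the trivial
  character plus h - 1 further coefficients of absolute value 1/h. In the product over the primes p
  dividing r, the factors 1 - 1/p make up \<theta>(r) and the twos are bounded by W(r); polynomials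
  behave alike. Each quotient by one of these subgroups is killed by a prime, namely p for the p-th
  powers and the characteristic for the additive kernels, so characters are built for this case only
  and general duality of finite abelian groups is avoided. The divisor l = n leaves no factor:
  normality over the whole field means that x is nonzero, which is built into summation over the
  multiplicative group.\<close>

definition characters :: "('a, 'b) monoid_scheme \<Rightarrow> ('a \<Rightarrow> complex) set"
  where "characters G = {\<psi>. (\<forall>x\<in>carrier G. cmod (\<psi> x) = 1) \<and>
    (\<forall>x\<in>carrier G. \<forall>y\<in>carrier G. \<psi> (x \<otimes>\<^bsub>G\<^esub> y) = \<psi> x * \<psi> y) \<and>
    (\<forall>x. x \<notin> carrier G \<longrightarrow> \<psi> x = 1)}"

lemma characters_norm: "\<psi> \<in> characters G \<Longrightarrow> x \<in> carrier G \<Longrightarrow> cmod (\<psi> x) = 1"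
  by (simp add: characters_def)

lemma characters_mult:
  "\<psi> \<in> characters G \<Longrightarrow> x \<in> carrier G \<Longrightarrow> y \<in> carrier G \<Longrightarrow> \<psi> (x \<otimes>\<^bsub>G\<^esub> y) = \<psi> x * \<psi> y"
  by (simp add: characters_def)

lemma characters_one: "(\<lambda>_. 1) \<in> characters G"
  by (simp add: characters_def)

lemma characters_times: "\<psi> \<in> characters G \<Longrightarrow> \<phi> \<in> characters G \<Longrightarrow> (\<lambda>x. \<psi> x * \<phi> x) \<in> characters G"
  by (simp add: characters_def norm_mult)

lemma characters_cnj: "\<psi> \<in> characters G \<Longrightarrow> (\<lambda>x. cnj (\<psi> x)) \<in> characters G"
  by (simp add: characters_def)

lemma characters_cnj_cancel:
  "\<psi> \<in> characters G \<Longrightarrow> x \<in> carrier G \<Longrightarrow> \<psi> x * cnj (\<psi> x) = 1"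
  by (simp add: characters_norm complex_norm_square [symmetric])

lemma (in group) characters_id: "\<psi> \<in> characters G \<Longrightarrow> \<psi> \<one> = 1"
  using characters_mult[of \<psi> G \<one> \<one>] characters_norm[of \<psi> G \<one>] by auto

lemma (in group) characters_pow:
  "\<psi> \<in> characters G \<Longrightarrow> x \<in> carrier G \<Longrightarrow> \<psi> (x [^] (n::nat)) = \<psi> x ^ n"
  by (induction n) (simp_all add: characters_id characters_mult)

lemma (in group) characters_ne_oneE:
  assumes "\<psi> \<in> characters G" "\<psi> \<noteq> (\<lambda>_. 1)"
  obtains x where "x \<in> carrier G" "\<psi> x \<noteq> 1"
  using assms unfolding characters_def by blast

text \<open>The values are roots of unity of order dividing \<open>order G\<close>. Fixing the value
  1 outside the carrier leaves finitely many functions and makes the constant 1 the only trivial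
  character.\<close>

lemma (in group) finite_characters:
  assumes "finite (carrier G)"
  shows "finite (characters G)"
proof (rule finite_subset)
  have "order G > 0"
    using assms by (simp add: order_gt_0_iff_finite)
  then have "finite {z :: complex. z ^ order G = 1}"
    by (simp add: finite_roots_unity)
  then show "finite {f. \<forall>x. (x \<in> carrier G \<longrightarrow> f x \<in> {z :: complex. z ^ order G = 1})
      \<and> (x \<notin> carrier G \<longrightarrow> f x = 1)}"
    by (rule finite_set_of_finite_funs[OF assms])
  show "characters G \<subseteq> {f. \<forall>x. (x \<in> carrier G \<longrightarrow> f x \<in> {z :: complex. z ^ order G = 1})
      \<and> (x \<notin> carrier G \<longrightarrow> f x = 1)}"
  proof (safe)
    fix f x assume f: "f \<in> characters G" and x: "x \<in> carrier G"
    have "f x ^ order G = f (x [^] order G)"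
      using f x by (simp add: characters_pow)
    then show "f x ^ order G = 1"
      using x f by (simp add: pow_order_eq_1 characters_id)
  qed (simp add: characters_def)
qed

text \<open>Translation by an \<open>a\<close> with \<open>\<psi> a \<noteq> 1\<close> permutes the
  group and multiplies the sum by \<open>\<psi> a\<close>.\<close>

lemma (in group) sum_character:
  assumes "\<psi> \<in> characters G" "\<psi> \<noteq> (\<lambda>_. 1)"
  shows "(\<Sum>x\<in>carrier G. \<psi> x) = 0"
proof -
  obtain a where a: "a \<in> carrier G" "\<psi> a \<noteq> 1"
    using assms by (rule characters_ne_oneE)
  have "(\<Sum>x\<in>carrier G. \<psi> x) = (\<Sum>x\<in>carrier G. \<psi> (a \<otimes> x))"
    by (rule sum.reindex_bij_witness[where i = "\<lambda>x. a \<otimes> x" and j = "\<lambda>x. inv a \<otimes> x"])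
       (simp_all add: a inv_solve_left m_assoc[symmetric])
  also have "\<dots> = \<psi> a * (\<Sum>x\<in>carrier G. \<psi> x)"
    using a assms by (simp add: characters_mult sum_distrib_left)
  finally show ?thesis
    using a by simp
qed

text \<open>
  If every \<open>y ^ p\<close> lies in \<open>H\<close>, a maximal subgroup \<open>M\<close> over \<open>H\<close> avoiding \<open>x\<close> satisfies
  \<open>G = M \<langle>x\<rangle>\<close> with index \<open>p\<close>, so \<open>m x^k \<mapsto> exp (2 \<pi> i k / p)\<close> is a character.
\<close>

lemma (in comm_group) character_separates:
  assumes fin: "finite (carrier G)" and p: "prime (p::nat)" and H: "subgroup H G"
    and pow: "\<And>y. y \<in> carrier G \<Longrightarrow> y [^] p \<in> H"
    and x: "x \<in> carrier G" "x \<notin> H"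
  obtains \<psi> where "\<psi> \<in> characters G" "\<And>h. h \<in> H \<Longrightarrow> \<psi> h = 1" "\<psi> x \<noteq> 1"
proof -
  let ?S = "{M. subgroup M G \<and> H \<subseteq> M \<and> x \<notin> M}"
  have "finite ?S"
    by (rule finite_subset[of _ "Pow (carrier G)"]) (auto simp: fin dest: subgroup.subset)
  moreover have "?S \<noteq> {}"
    using H x by blast
  ultimately have "\<exists>M\<in>?S. \<forall>M'\<in>?S. M \<subseteq> M' \<longrightarrow> M = M'"
    by (rule finite_has_maximal)
  then obtain M where M: "M \<in> ?S" and max0: "\<forall>M'\<in>?S. M \<subseteq> M' \<longrightarrow> M = M'"
    by (elim bexE)
  have max: "M = M'" if "subgroup M' G" "H \<subseteq> M'" "x \<notin> M'" "M \<subseteq> M'" for M'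
    using max0 that by simp
  have sM: "subgroup M G" and HM: "H \<subseteq> M" and xM: "x \<notin> M"
    using M by auto
  note Mm = subgroup.m_closed[OF sM] and Mc = subgroup.mem_carrier[OF sM]
    and Mi = subgroup.m_inv_closed[OF sM] and M1 = subgroup.one_closed[OF sM]
  have powM: "y [^] (p * j) \<in> M" if "y \<in> carrier G" for y and j :: nat
  proof -
    have "y [^] p \<in> M" using pow[OF that] HM by blast
    then have "(y [^] p) [^] j \<in> M"
      by (induction j) (auto intro: M1 Mm)
    then show ?thesis using that by (simp add: nat_pow_pow)
  qed
  \<comment> \<open>If k were prime to p, Bezout's relation k a = p b + 1 would recover y from
    \<open>y [^] k\<close> and \<open>y [^] (p * b)\<close>, both in M.\<close>
  have dvdM: "p dvd k" if "y \<in> carrier G" "y \<notin> M" "y [^] (k::nat) \<in> M" for y k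
  proof (rule ccontr)
    assume "\<not> p dvd k"
    then have cop: "coprime k p"
      using p prime_imp_coprime coprime_commute by blast
    then obtain a b where ab: "k * a = p * b + 1"
      using bezout_nat[of k p] p by (metis coprime_iff_gcd_eq_1 add.commute not_prime_0 \<open>\<not> p dvd k\<close> dvd_0_right)
    have "(y [^] k) [^] a \<in> M"
      using that(3) by (induction a) (auto intro: M1 Mm)
    then have "y [^] (p * b) \<otimes> y \<in> M"
      using that ab by (simp add: nat_pow_pow)
    then have "inv (y [^] (p * b)) \<otimes> (y [^] (p * b) \<otimes> y) \<in> M"
      using Mm Mi powM that by blast
    then show False
      using that by (simp add: m_assoc[symmetric])
  qed
  \<comment> \<open>An element y outside M generates with M a larger subgroup, which contains x by
    maximality. The exponent of y in x is prime to p because x is not in M, and inverting it modulo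
    p expresses y through M and x.\<close>
  have decomp: "\<exists>m\<in>M. \<exists>k. y = m \<otimes> x [^] (k::nat)" if y: "y \<in> carrier G" for y
  proof (cases "y \<in> M")
    case True
    then show ?thesis using y by (intro bexI[of _ y] exI[of _ 0]) auto
  next
    case False
    let ?M' = "{m \<otimes> y [^] k | m (k::nat). m \<in> M}"
    have "subgroup ?M' G"
    proof (rule subgroupI)
      show "?M' \<subseteq> carrier G" using y Mc by auto
      show "?M' \<noteq> {}" using M1 by auto
    next
      fix a assume "a \<in> ?M'"
      then obtain m k where mk: "m \<in> M" "a = m \<otimes> y [^] (k::nat)" by blast
      have p0: "p > 0" using p prime_gt_0_nat by blast
      \<comment> \<open>As \<open>y [^] p\<close> lies in M, the inverse of \<open>y [^] k\<close>
        can be traded for the natural power with exponent (p - 1) k.\<close>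
      have e: "y [^] (p * k) = y [^] k \<otimes> y [^] ((p - 1) * k)"
        using y p0 by (simp add: nat_pow_mult diff_mult_distrib)
      have "inv a = (inv m \<otimes> inv (y [^] (p * k))) \<otimes> y [^] ((p - 1) * k)"
        unfolding e using mk y Mc by (simp add: inv_mult m_ac)
      moreover have "inv m \<otimes> inv (y [^] (p * k)) \<in> M"
        using mk y powM Mm Mi by blast
      ultimately show "inv a \<in> ?M'" by blast
    next
      fix a b assume "a \<in> ?M'" "b \<in> ?M'"
      then obtain m k n j where "m \<in> M" "a = m \<otimes> y [^] (k::nat)" "n \<in> M" "b = n \<otimes> y [^] (j::nat)"
        by blast
      then have "a \<otimes> b = (m \<otimes> n) \<otimes> y [^] (k + j)" "m \<otimes> n \<in> M"
        using y Mc Mm by (simp_all add: nat_pow_mult[symmetric] m_ac)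
      then show "a \<otimes> b \<in> ?M'" by blast
    qed
    moreover have "M \<subseteq> ?M'"
    proof
      fix m assume "m \<in> M"
      then have "m = m \<otimes> y [^] (0::nat)" using Mc by simp
      then show "m \<in> ?M'" using \<open>m \<in> M\<close> by blast
    qed
    moreover have "y \<in> ?M'"
      using y M1 by (auto intro!: exI[of _ \<one>] exI[of _ 1])
    ultimately have "x \<in> ?M'"
      using max[of ?M'] HM False by fast
    then obtain m k where mk: "m \<in> M" "x = m \<otimes> y [^] (k::nat)" by blast
    have "\<not> p dvd k"
    proof
      assume "p dvd k"
      then have "y [^] k \<in> M" using powM y by (auto elim!: dvdE)
      then show False using mk xM Mm by blast
    qed
    then have "coprime k p"
      using p prime_imp_coprime coprime_commute by blast
    then obtain a b where ab: "k * a = p * b + 1"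
      using bezout_nat[of k p] p by (metis coprime_iff_gcd_eq_1 add.commute not_prime_0 \<open>\<not> p dvd k\<close> dvd_0_right)
    have "x [^] a = m [^] a \<otimes> (y [^] (p * b) \<otimes> y)"
      using mk y Mc ab by (simp add: pow_mult_distrib m_comm nat_pow_pow)
    then have "(inv (m [^] a) \<otimes> inv (y [^] (p * b))) \<otimes> x [^] a
        = (inv (m [^] a) \<otimes> m [^] a) \<otimes> (inv (y [^] (p * b)) \<otimes> y [^] (p * b)) \<otimes> y"
      using mk y Mc by (simp add: m_ac del: l_inv r_inv)
    then have "y = (inv (m [^] a) \<otimes> inv (y [^] (p * b))) \<otimes> x [^] a"
      using mk y Mc by simp
    moreover have "m [^] a \<in> M"
      using mk(1) by (induction a) (auto intro: M1 Mm)
    ultimately show ?thesis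
      using Mm Mi powM y by blast
  qed
  have unique: "[k = j] (mod p)"
    if "m \<in> M" "n \<in> M" "m \<otimes> x [^] (k::nat) = n \<otimes> x [^] (j::nat)" for m n k j
  proof -
    have *: "[k = j] (mod p)"
      if "m \<in> M" "n \<in> M" "m \<otimes> x [^] (k::nat) = n \<otimes> x [^] (j::nat)" "k \<le> j" for m n k j
    proof -
      have "m \<otimes> x [^] k = (n \<otimes> x [^] (j - k)) \<otimes> x [^] k"
        using that x Mc by (simp add: m_assoc nat_pow_mult)
      then have "m = n \<otimes> x [^] (j - k)"
        using that x Mc by simp
      then have "x [^] (j - k) = inv n \<otimes> m"
        using that x Mc by (simp add: m_assoc[symmetric])
      then have "p dvd j - k"
        using dvdM[OF x(1) xM] Mm Mi that by metis
      then show ?thesis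
        using that(4) by (metis cong_altdef_nat' cong_sym_eq cong_altdef_nat)
    qed
    show ?thesis
      using *[OF that] *[OF that(2,1) that(3)[symmetric]] by (meson cong_sym nat_le_linear)
  qed
  define \<zeta> where "\<zeta> = cis (2 * pi / p)"
  have p1: "p > 1" using p prime_gt_1_nat by blast
  have \<zeta>p: "\<zeta> ^ p = 1"
    using p1 by (simp add: \<zeta>_def DeMoivre)
  have \<zeta>1: "\<zeta> \<noteq> 1"
  proof
    assume "\<zeta> = 1"
    then have "cos (2 * pi / p) = 1" by (simp add: \<zeta>_def complex_eq_iff)
    then obtain n :: int where "2 * pi / p = of_int n * 2 * pi"
      using cos_one_2pi_int by auto
    then have "(2 * pi) * 1 = (2 * pi) * (of_int n * real p)"
      using p1 by (simp add: field_simps)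
    then have "1 = of_int n * real p"
      by (subst (asm) mult_cancel_left) simp
    then have "real_of_int 1 = real_of_int (n * int p)" by simp
    then have "1 = n * int p" by (simp only: of_int_eq_iff)
    then have "int p dvd 1" by (metis dvd_triv_right)
    then show False using p1 by simp
  qed
  have \<zeta>cong: "\<zeta> ^ k = \<zeta> ^ j" if "[k = j] (mod p)" for k j
  proof -
    have "\<zeta> ^ k = \<zeta> ^ (k mod p)" for k
    proof -
      have "\<zeta> ^ k = \<zeta> ^ (p * (k div p) + k mod p)" by simp
      also have "\<dots> = \<zeta> ^ (k mod p)" by (simp only: power_add power_mult \<zeta>p power_one mult_1)
      finally show ?thesis .
    qed
    then show ?thesis using that by (metis cong_def)
  qed
  \<comment> \<open>An arbitrary admissible exponent: by \<open>unique\<close> and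
    \<open>\<zeta>cong\<close> the value \<open>\<zeta> ^ e y\<close> does not depend on the
    choice.\<close>
  define e where "e y = (SOME k::nat. \<exists>m\<in>M. y = m \<otimes> x [^] k)" for y
  have e: "\<exists>m\<in>M. y = m \<otimes> x [^] e y" if "y \<in> carrier G" for y
    unfolding e_def by (rule someI_ex) (use decomp[OF that] in blast)
  define \<psi> where "\<psi> y = (if y \<in> carrier G then \<zeta> ^ e y else 1)" for y
  have \<psi>: "\<psi> (m \<otimes> x [^] k) = \<zeta> ^ k" if "m \<in> M" for m k
  proof -
    have c: "m \<otimes> x [^] k \<in> carrier G" using that x Mc by simp
    then show ?thesis
      using e[OF c] unique that unfolding \<psi>_def by (auto intro!: \<zeta>cong)
  qed
  have "\<psi> \<in> characters G"
    unfolding characters_def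
  proof (safe)
    fix y z assume yz: "y \<in> carrier G" "z \<in> carrier G"
    then obtain m k n j where mk: "m \<in> M" "y = m \<otimes> x [^] (k::nat)" "n \<in> M" "z = n \<otimes> x [^] (j::nat)"
      using decomp by meson
    have "y \<otimes> z = (m \<otimes> n) \<otimes> x [^] (k + j)"
      using mk x Mc by (simp add: nat_pow_mult[symmetric] m_ac)
    then show "\<psi> (y \<otimes> z) = \<psi> y * \<psi> z"
      using mk Mm \<psi> by (simp add: power_add)
  qed (auto simp: \<psi>_def \<zeta>_def norm_power)
  moreover have "\<psi> h = 1" if "h \<in> H" for h
    using \<psi>[of h 0] that HM Mc by auto
  moreover have "\<psi> x \<noteq> 1"
    using \<psi>[OF M1, of 1] x \<zeta>1 by simp
  ultimately show ?thesis
    using that by blast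
qed

text \<open>If x is outside H, multiplication by a member of A that is nontrivial at x permutes A,
  so the sum over A vanishes; on H every term is 1.\<close>

lemma (in comm_group) indicator_subgroup_eq_sum_characters:
  assumes fin: "finite (carrier G)" and p: "prime (p::nat)" and H: "subgroup H G"
    and pow: "\<And>y. y \<in> carrier G \<Longrightarrow> y [^] p \<in> H"
  defines "A \<equiv> {\<psi> \<in> characters G. \<forall>h\<in>H. \<psi> h = 1}"
  shows "x \<in> carrier G \<Longrightarrow> of_bool (x \<in> H) = (\<Sum>\<psi>\<in>A. \<psi> x) / of_nat (card A)"
    and "card A * card H = order G"
proof -
  have finA: "finite A"
    using finite_characters[OF fin] by (simp add: A_def)
  have oneA: "(\<lambda>_. 1) \<in> A"
    by (simp add: A_def characters_one)
  then have cA: "card A > 0"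
    using finA by (auto simp: card_gt_0_iff)
  have orth: "(\<Sum>\<psi>\<in>A. \<psi> x) = of_nat (card A) * of_bool (x \<in> H)" if x: "x \<in> carrier G" for x
  proof (cases "x \<in> H")
    case True
    then show ?thesis by (simp add: A_def)
  next
    case False
    obtain \<phi> where \<phi>: "\<phi> \<in> characters G" "\<And>h. h \<in> H \<Longrightarrow> \<phi> h = 1" "\<phi> x \<noteq> 1"
      using character_separates[OF fin p H pow x False] by blast
    \<comment> \<open>Needed also for y outside the carrier, because multiplication by
      \<open>\<phi>\<close> is inverted as an operation on functions.\<close>
    have nz: "\<phi> y * cnj (\<phi> y) = 1" for y
      using \<phi>(1) by (cases "y \<in> carrier G") (simp_all add: characters_cnj_cancel, simp add: characters_def)
    have "(\<Sum>\<psi>\<in>A. \<psi> x) = (\<Sum>\<psi>\<in>A. \<phi> x * \<psi> x)"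
      by (rule sum.reindex_bij_witness[where i = "\<lambda>\<psi> y. \<phi> y * \<psi> y" and j = "\<lambda>\<psi> y. cnj (\<phi> y) * \<psi> y"])
         (use \<phi> nz in \<open>auto simp: A_def mult.assoc[symmetric] characters_times characters_cnj mult.commute[of "cnj _"]\<close>)
    also have "\<dots> = \<phi> x * (\<Sum>\<psi>\<in>A. \<psi> x)"
      by (simp add: sum_distrib_left)
    finally show ?thesis
      using \<phi>(3) False by simp
  qed
  then show "of_bool (x \<in> H) = (\<Sum>\<psi>\<in>A. \<psi> x) / of_nat (card A)" if "x \<in> carrier G"
    using that cA by simp
  \<comment> \<open>Double counting: summing over x first leaves only the trivial character, summing
    over \<open>\<psi>\<close> first leaves \<open>card A\<close> for each element of H.\<close>
  have "of_nat (order G) = (\<Sum>\<psi>\<in>A. \<Sum>x\<in>carrier G. \<psi> x)"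
  proof -
    have "(\<Sum>\<psi>\<in>A. \<Sum>x\<in>carrier G. \<psi> x) = (\<Sum>\<psi>\<in>A. if \<psi> = (\<lambda>_. 1) then of_nat (order G) else 0)"
      by (rule sum.cong) (auto simp: A_def sum_character order_def)
    then show ?thesis using finA oneA by simp
  qed
  also have "\<dots> = (\<Sum>x\<in>carrier G. of_nat (card A) * of_bool (x \<in> H))"
    by (subst sum.swap) (simp add: orth)
  also have "\<dots> = of_nat (card A * card H)"
    using fin subgroup.subset[OF H] by (simp add: sum_distrib_left[symmetric] Int_absorb1 flip: Int_def)
  finally show "card A * card H = order G"
    by (metis of_nat_eq_iff)
qed

section \<open>Functions with bounded Fourier norm\<close>

text \<open>
  \<open>fourier_bound G f c\<close>: on \<open>carrier G\<close>, the function \<open>f\<close> is a combination of characters whose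
  coefficients have absolute values summing up to at most \<open>c\<close>.
\<close>

inductive fourier_bound :: "('a, 'b) monoid_scheme \<Rightarrow> ('a \<Rightarrow> complex) \<Rightarrow> real \<Rightarrow> bool"
  for G where
  character: "\<psi> \<in> characters G \<Longrightarrow> fourier_bound G \<psi> 1"
| scale: "fourier_bound G f c \<Longrightarrow> fourier_bound G (\<lambda>x. a * f x) (cmod a * c)"
| add: "fourier_bound G f c \<Longrightarrow> fourier_bound G g d \<Longrightarrow> fourier_bound G (\<lambda>x. f x + g x) (c + d)"
| weaken: "fourier_bound G f c \<Longrightarrow> (\<And>x. x \<in> carrier G \<Longrightarrow> g x = f x) \<Longrightarrow> c \<le> d \<Longrightarrow> fourier_bound G g d"

lemma fourier_bound_nonneg: "fourier_bound G f c \<Longrightarrow> c \<ge> 0"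
  by (induction rule: fourier_bound.induct) auto

lemma fourier_bound_zero: "fourier_bound G (\<lambda>_. 0) 0"
  using fourier_bound.scale[OF fourier_bound.character[OF characters_one], of _ 0] by simp

lemma fourier_bound_sum:
  "finite I \<Longrightarrow> (\<And>i. i \<in> I \<Longrightarrow> fourier_bound G (f i) (c i)) \<Longrightarrow>
    fourier_bound G (\<lambda>x. \<Sum>i\<in>I. f i x) (\<Sum>i\<in>I. c i)"
proof (induction I rule: finite_induct)
  case (insert i I)
  then show ?case
    by (simp add: fourier_bound.add)
qed (simp add: fourier_bound_zero)

text \<open>Products of characters are characters, and the rest is bilinearity. The inductive form
  of \<open>fourier_bound\<close> replaces a convolution of explicit coefficient families by two
  nested inductions.\<close>

lemma fourier_bound_mult:
  assumes "fourier_bound G f c" "fourier_bound G g d"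
  shows "fourier_bound G (\<lambda>x. f x * g x) (c * d)"
  using assms
proof (induction rule: fourier_bound.induct)
  case (character \<psi>)
  from character(2,1) show ?case
  proof (induction rule: fourier_bound.induct)
    case (character \<phi>)
    then show ?case by (simp add: fourier_bound.character characters_times)
  next
    case (scale f c a)
    then have "fourier_bound G (\<lambda>x. a * (\<psi> x * f x)) (cmod a * (1 * c))"
      by (intro fourier_bound.scale)
    then show ?case by (simp add: mult_ac)
  next
    case (add f c g d)
    then have "fourier_bound G (\<lambda>x. \<psi> x * f x + \<psi> x * g x) (1 * c + 1 * d)"
      by (intro fourier_bound.add)
    then show ?case by (simp add: distrib_left)
  next
    case (weaken f c g d)
    show ?case
      by (rule fourier_bound.weaken[of G "\<lambda>x. \<psi> x * f x" "1 * c"]) (use weaken in simp_all)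
  qed
next
  case (scale f c a)
  then have "fourier_bound G (\<lambda>x. a * (f x * g x)) (cmod a * (c * d))"
    by (intro fourier_bound.scale)
  then show ?case by (simp add: mult_ac)
next
  case (add f c f' c')
  then have "fourier_bound G (\<lambda>x. f x * g x + f' x * g x) (c * d + c' * d)"
    by (intro fourier_bound.add)
  then show ?case by (simp add: distrib_right)
next
  case (weaken f c f' c')
  have "d \<ge> 0" using weaken.prems by (rule fourier_bound_nonneg)
  show ?case
    by (rule fourier_bound.weaken[of G "\<lambda>x. f x * g x" "c * d"])
       (use weaken \<open>d \<ge> 0\<close> in \<open>simp_all add: mult_right_mono\<close>)
qed

lemma fourier_bound_prod:
  "finite I \<Longrightarrow> (\<And>i. i \<in> I \<Longrightarrow> fourier_bound G (f i) (c i)) \<Longrightarrow>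
    fourier_bound G (\<lambda>x. \<Prod>i\<in>I. f i x) (\<Prod>i\<in>I. c i)"
proof (induction I rule: finite_induct)
  case (insert i I)
  then show ?case
    by (simp add: fourier_bound_mult)
qed (simp add: fourier_bound.character characters_one)

text \<open>With N characters trivial on H, the expansion has the coefficient 1 - 1/N at the trivial
  one and -1/N at the N - 1 others. The absolute values add up to 2 (1 - 1/N), which grows with N;
  hence an upper bound h for the index suffices.\<close>

lemma (in comm_group) fourier_bound_compl_subgroup:
  assumes fin: "finite (carrier G)" and p: "prime (p::nat)" and H: "subgroup H G"
    and pow: "\<And>y. y \<in> carrier G \<Longrightarrow> y [^] p \<in> H"
    and h: "order G \<le> card H * h"
  shows "fourier_bound G (\<lambda>x. of_bool (x \<notin> H)) (2 * (1 - 1 / real h))"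
proof -
  define A where "A = {\<psi> \<in> characters G. \<forall>h\<in>H. \<psi> h = 1}"
  have ind1: "of_bool (x \<in> H) = (\<Sum>\<psi>\<in>A. \<psi> x) / of_nat (card A)" if "x \<in> carrier G" for x
    unfolding A_def by (rule indicator_subgroup_eq_sum_characters(1)[OF fin p H _ that]) (rule pow)
  have ind2: "card A * card H = order G"
    unfolding A_def by (rule indicator_subgroup_eq_sum_characters(2)[OF fin p H]) (rule pow)
  have finA: "finite A"
    using finite_characters[OF fin] by (simp add: A_def)
  have oneA: "(\<lambda>_. 1) \<in> A"
    by (simp add: A_def characters_one)
  then have cA: "card A > 0"
    using finA by (auto simp: card_gt_0_iff)
  have "finite H" "H \<noteq> {}"
    using fin subgroup.subset[OF H] subgroup.one_closed[OF H] by (auto intro: finite_subset)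
  then have "card H > 0" by (simp add: card_gt_0_iff)
  moreover have "card H * card A \<le> card H * h"
    using h ind2 by (simp add: mult.commute)
  ultimately have Ah: "card A \<le> h" by simp
  define w :: real where "w = 1 / card A"
  let ?f = "\<lambda>x. of_real (1 - w) * 1 + of_real (- w) * (\<Sum>\<psi>\<in>A - {\<lambda>_. 1}. \<psi> x)"
  have w: "0 \<le> w" "w \<le> 1" using cA by (simp_all add: w_def)
  have "fourier_bound G ?f (cmod (of_real (1 - w)) * 1 + cmod (of_real (- w)) * (\<Sum>\<psi>\<in>A - {\<lambda>_. 1}. 1))"
    by (intro fourier_bound.add fourier_bound.scale fourier_bound_sum fourier_bound.character characters_one)
       (use finA in \<open>auto simp: A_def\<close>)
  then show ?thesis
  proof (rule fourier_bound.weaken)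
    fix x assume x: "x \<in> carrier G"
    have "of_bool (x \<notin> H) = (1 :: complex) - of_bool (x \<in> H)" by simp
    also have "of_bool (x \<in> H) = of_real w * (\<Sum>\<psi>\<in>A. \<psi> x)"
      using ind1[OF x] by (simp add: w_def)
    also have "(\<Sum>\<psi>\<in>A. \<psi> x) = 1 + (\<Sum>\<psi>\<in>A - {\<lambda>_. 1}. \<psi> x)"
      using finA oneA by (simp add: sum.remove)
    finally show "of_bool (x \<notin> H) = ?f x"
      by (simp add: algebra_simps)
  next
    have "cmod (of_real (1 - w)) * 1 + cmod (of_real (- w)) * (\<Sum>\<psi>\<in>A - {\<lambda>_. 1}. 1)
        = (1 - w) + w * (real (card A) - 1)"
      using w finA oneA cA by (simp add: of_nat_diff del: of_real_diff)
    also have "\<dots> = 2 * (1 - w)"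
      using cA by (simp add: w_def field_simps)
    also have "\<dots> \<le> 2 * (1 - 1 / real h)"
      using cA Ah by (simp add: w_def frac_le)
    finally show "cmod (of_real (1 - w)) * 1 + cmod (of_real (- w)) * (\<Sum>\<psi>\<in>A - {\<lambda>_. 1}. 1)
        \<le> 2 * (1 - 1 / real h)" .
  qed
qed

section \<open>Gauss sums and \<open>r\<close>-free elements\<close>

lemma (in field) comm_group_mult_of: "comm_group (Multiplicative_Group.mult_of R)"
  by (rule group.group_comm_groupI[OF field_mult_group]) (auto simp: m_comm)

text \<open>For nontrivial \<open>\<psi>\<close> the squared modulus is exactly
  \<open>order R\<close>. Substituting x = t y in the double sum separates \<chi>(t) from \<psi>((t
  - 1) y); the sum over y concentrates on t = 1, up to a constant that disappears against the
  vanishing sum of \<open>\<chi>\<close>.\<close>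

lemma (in field) gauss_sum_bound:
  assumes fin: "finite (carrier R)"
    and \<chi>: "\<chi> \<in> characters (Multiplicative_Group.mult_of R)" "\<chi> \<noteq> (\<lambda>_. 1)"
    and \<psi>: "\<psi> \<in> characters (add_monoid R)"
  shows "cmod (\<Sum>x\<in>carrier R - {\<zero>}. \<chi> x * \<psi> x) \<le> sqrt (real (order R))"
proof -
  interpret M: group "Multiplicative_Group.mult_of R" by (rule field_mult_group)
  let ?U = "carrier R - {\<zero>}"
  have sum\<chi>: "(\<Sum>x\<in>?U. \<chi> x) = 0"
    using M.sum_character[OF \<chi>] by simp
  note \<chi>m = characters_mult[OF \<chi>(1), simplified] and \<psi>m = characters_mult[OF \<psi>, simplified]
  note \<chi>c = characters_cnj_cancel[OF \<chi>(1), simplified] and \<psi>c = characters_cnj_cancel[OF \<psi>, simplified]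
  define S where "S = (\<Sum>x\<in>?U. \<chi> x * \<psi> x)"
  show ?thesis
  proof (cases "\<psi> = (\<lambda>_. 1)")
    case True
    then show ?thesis using sum\<chi> by simp
  next
    case False
    have sum\<psi>: "(\<Sum>x\<in>carrier R. \<psi> x) = 0"
      using group.sum_character[OF add.is_group \<psi> False] by simp
    \<comment> \<open>Over the whole carrier orthogonality gives \<open>order R\<close> or 0;
      leaving out y = \<zero> costs the term 1.\<close>
    have inner: "(\<Sum>y\<in>?U. \<psi> ((t \<ominus> \<one>) \<otimes> y)) = of_nat (order R) * of_bool (t = \<one>) - 1"
      if t: "t \<in> ?U" for t
    proof -
      have "(\<Sum>y\<in>carrier R. \<psi> ((t \<ominus> \<one>) \<otimes> y)) = of_nat (order R) * of_bool (t = \<one>)"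
      proof (cases "t = \<one>")
        case True
        then show ?thesis
          using group.characters_id[OF add.is_group \<psi>] by (simp add: order_def r_neg a_minus_def)
      next
        case False
        define s where "s = t \<ominus> \<one>"
        have s: "s \<in> Units R"
          using t False by (simp add: s_def field_Units)
        have "(\<Sum>y\<in>carrier R. \<psi> (s \<otimes> y)) = (\<Sum>y\<in>carrier R. \<psi> y)"
          by (rule sum.reindex_bij_witness[where i = "\<lambda>y. inv s \<otimes> y" and j = "\<lambda>y. s \<otimes> y"])
             (use s in \<open>auto simp: m_assoc[symmetric] Units_closed\<close>)
        then show ?thesis using False sum\<psi> by (simp add: s_def)
      qed
      moreover have "(\<Sum>y\<in>carrier R. \<psi> ((t \<ominus> \<one>) \<otimes> y)) = 1 + (\<Sum>y\<in>?U. \<psi> ((t \<ominus> \<one>) \<otimes> y))"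
        using fin t group.characters_id[OF add.is_group \<psi>] by (simp add: sum.remove[of _ \<zero>])
      ultimately show ?thesis by (simp only: eq_diff_eq add.commute)
    qed
    have "S * cnj S = (\<Sum>y\<in>?U. \<Sum>x\<in>?U. \<chi> x * \<psi> x * cnj (\<chi> y * \<psi> y))"
      unfolding S_def by (simp add: sum_product cnj_sum) (rule sum.swap)
    also have "\<dots> = (\<Sum>y\<in>?U. \<Sum>t\<in>?U. \<chi> t * \<psi> ((t \<ominus> \<one>) \<otimes> y))"
    proof (rule sum.cong[OF refl])
      fix y assume y: "y \<in> ?U"
      have yU: "y \<in> Units R" using y by (simp add: field_Units)
      have "(\<Sum>x\<in>?U. \<chi> x * \<psi> x * cnj (\<chi> y * \<psi> y))
          = (\<Sum>t\<in>?U. \<chi> (t \<otimes> y) * \<psi> (t \<otimes> y) * cnj (\<chi> y * \<psi> y))"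
        by (rule sum.reindex_bij_witness[where i = "\<lambda>t. t \<otimes> y" and j = "\<lambda>x. x \<otimes> inv y"])
           (use y yU Units_inv_Units[OF yU] in \<open>auto simp: m_assoc field_Units integral_iff\<close>)
      also have "\<dots> = (\<Sum>t\<in>?U. \<chi> t * \<psi> ((t \<ominus> \<one>) \<otimes> y))"
      proof (rule sum.cong[OF refl])
        fix t assume t: "t \<in> ?U"
        have "t \<otimes> y = (t \<ominus> \<one>) \<otimes> y \<oplus> y"
          using t y by (simp add: a_minus_def l_distr l_minus a_assoc l_neg)
        then have "\<psi> (t \<otimes> y) = \<psi> ((t \<ominus> \<one>) \<otimes> y) * \<psi> y"
          using t y \<psi>m by simp
        moreover have "\<chi> (t \<otimes> y) = \<chi> t * \<chi> y"
          using t y \<chi>m by simp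
        ultimately have "\<chi> (t \<otimes> y) * \<psi> (t \<otimes> y) * cnj (\<chi> y * \<psi> y)
            = \<chi> t * \<psi> ((t \<ominus> \<one>) \<otimes> y) * (\<chi> y * cnj (\<chi> y)) * (\<psi> y * cnj (\<psi> y))"
          by (simp only: complex_cnj_mult mult_ac)
        then show "\<chi> (t \<otimes> y) * \<psi> (t \<otimes> y) * cnj (\<chi> y * \<psi> y) = \<chi> t * \<psi> ((t \<ominus> \<one>) \<otimes> y)"
          using y \<chi>c[of y] \<psi>c[of y] by (simp del: complex_cnj_mult)
      qed
      finally show "(\<Sum>x\<in>?U. \<chi> x * \<psi> x * cnj (\<chi> y * \<psi> y)) = (\<Sum>t\<in>?U. \<chi> t * \<psi> ((t \<ominus> \<one>) \<otimes> y))" .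
    qed
    also have "\<dots> = (\<Sum>t\<in>?U. \<chi> t * (\<Sum>y\<in>?U. \<psi> ((t \<ominus> \<one>) \<otimes> y)))"
      by (subst sum.swap) (simp add: sum_distrib_left)
    also have "\<dots> = (\<Sum>t\<in>?U. \<chi> t * (of_nat (order R) * of_bool (t = \<one>) - 1))"
      by (rule sum.cong) (simp_all add: inner)
    also have "\<dots> = (\<Sum>t\<in>?U. of_nat (order R) * (of_bool (t = \<one>) * \<chi> t)) - (\<Sum>t\<in>?U. \<chi> t)"
      by (simp add: sum_subtractf algebra_simps)
    also have "(\<Sum>t\<in>?U. of_nat (order R) * (of_bool (t = \<one>) * \<chi> t)) = of_nat (order R)"
    proof -
      have "(\<Sum>t\<in>?U. of_bool (t = \<one>) * \<chi> t) = (\<Sum>t\<in>?U. if t = \<one> then \<chi> \<one> else 0)"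
        by (rule sum.cong) auto
      also have "\<dots> = 1"
        using fin M.characters_id[OF \<chi>(1)] by simp
      finally show ?thesis by (simp add: sum_distrib_left[symmetric])
    qed
    finally have "S * cnj S = of_nat (order R)"
      using sum\<chi> by simp
    then have "of_real ((cmod S)\<^sup>2) = (of_real (real (order R)) :: complex)"
      by (simp only: complex_norm_square[symmetric] of_real_of_nat_eq)
    then have "(cmod S)\<^sup>2 = real (order R)"
      by (simp only: of_real_eq_iff)
    then have "cmod S = sqrt (real (order R))"
      by (metis norm_ge_zero real_sqrt_unique)
    then show ?thesis by (simp add: S_def)
  qed
qed

text \<open>The expression is bilinear in f and g, which reduces it to a pair of characters.
  Subtracting the mean annihilates the trivial \<open>\<chi>\<close> and changes no other one, since
  the others have mean 0; a Gauss sum is left.\<close>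

lemma (in field) fourier_bound_correlation:
  assumes fin: "finite (carrier R)"
    and f: "fourier_bound (Multiplicative_Group.mult_of R) f c" and g: "fourier_bound (add_monoid R) g d"
  defines "U \<equiv> carrier R - {\<zero>}"
  shows "cmod (\<Sum>x\<in>U. (f x - (\<Sum>y\<in>U. f y) / of_nat (card U)) * g x) \<le> sqrt (real (order R)) * c * d"
proof -
  interpret M: group "Multiplicative_Group.mult_of R" by (rule field_mult_group)
  have "finite U" "\<one> \<in> U" using fin by (auto simp: U_def)
  then have cU: "card U \<noteq> 0" by auto
  define L where "L f g = (\<Sum>x\<in>U. (f x - (\<Sum>y\<in>U. f y) / of_nat (card U)) * g x)"
    for f g :: "'a \<Rightarrow> complex"
  let ?s = "sqrt (real (order R))"
  have L_cong: "L f g = L f' g'" if "\<And>x. x \<in> U \<Longrightarrow> f x = f' x" "\<And>x. x \<in> U \<Longrightarrow> g x = g' x" for f f' g g'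
    unfolding L_def using that by (simp cong: sum.cong)
  have L_scale1: "L (\<lambda>x. a * f x) g = a * L f g" for a f g
    unfolding L_def by (simp add: sum_distrib_left[symmetric] algebra_simps)
       (simp add: sum_distrib_left algebra_simps flip: sum_divide_distrib)
  have L_scale2: "L f (\<lambda>x. a * g x) = a * L f g" for a f g
    unfolding L_def by (simp add: sum_distrib_left algebra_simps)
  have L_add1: "L (\<lambda>x. f x + f' x) g = L f g + L f' g" for f f' g
    unfolding L_def sum.distrib[symmetric]
    by (rule sum.cong[OF refl]) (simp add: sum.distrib add_divide_distrib algebra_simps)
  have L_add2: "L f (\<lambda>x. g x + g' x) = L f g + L f g'" for f g g'
    unfolding L_def sum.distrib[symmetric] by (rule sum.cong[OF refl]) (simp add: add_divide_distrib algebra_simps)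
  have "cmod (L f g) \<le> ?s * c * d"
    using f g
  proof (induction f c rule: fourier_bound.induct)
    case (character \<chi>)
    from character(2,1) have "cmod (L \<chi> g) \<le> ?s * d"
    proof (induction g d rule: fourier_bound.induct)
      case (character \<psi>)
      show ?case
      proof (cases "\<chi> = (\<lambda>_. 1)")
        case True
        then show ?thesis using cU by (simp add: L_def)
      next
        case False
        then have "L \<chi> \<psi> = (\<Sum>x\<in>U. \<chi> x * \<psi> x)"
          using M.sum_character[OF character(2)] by (simp add: L_def U_def)
        then show ?thesis
          using gauss_sum_bound[OF fin character(2) False character(1)] by (simp add: U_def)
      qed
    next
      case (scale f c a)
      then have "cmod a * cmod (L \<chi> f) \<le> cmod a * (?s * c)"
        by (intro mult_left_mono) auto
      then show ?case by (simp add: L_scale2 norm_mult algebra_simps)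
    next
      case (add f c g d)
      then show ?case
        using norm_triangle_ineq[of "L \<chi> f" "L \<chi> g"] by (simp add: L_add2 algebra_simps)
    next
      case (weaken f c g d)
      have "L \<chi> g = L \<chi> f" by (rule L_cong) (use weaken(2) in \<open>auto simp: U_def\<close>)
      moreover have "?s * c \<le> ?s * d" using weaken(3) by (simp add: mult_left_mono)
      ultimately show ?case using weaken by simp
    qed
    then show ?case by simp
  next
    case (scale f c a)
    then have "cmod a * cmod (L f g) \<le> cmod a * (?s * c * d)"
      by (intro mult_left_mono) auto
    then show ?case by (simp add: L_scale1 norm_mult algebra_simps)
  next
    case (add f c f' c')
    then show ?case
      using norm_triangle_ineq[of "L f g" "L f' g"] by (simp add: L_add1 algebra_simps)
  next
    case (weaken f c f' c')
    have d: "d \<ge> 0" using weaken.prems by (rule fourier_bound_nonneg)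
    have "L f' g = L f g" by (rule L_cong) (use weaken(2) in \<open>auto simp: U_def\<close>)
    moreover have "?s * c * d \<le> ?s * c' * d" using weaken(3) d by (simp add: mult_left_mono mult_right_mono)
    ultimately show ?case using weaken by simp
  qed
  then show ?thesis unfolding L_def .
qed

section \<open>Subgroups of powers and the number of free elements\<close>

lemma (in comm_group) subgroup_pow_image:
  "subgroup ((\<lambda>x. x [^] (k::nat)) ` carrier G) G"
proof (rule subgroupI)
  show "(\<lambda>x. x [^] k) ` carrier G \<noteq> {}" by auto
next
  fix a assume "a \<in> (\<lambda>x. x [^] k) ` carrier G"
  then obtain x where x: "x \<in> carrier G" "a = x [^] k" by blast
  then have "inv a = (inv x) [^] k" by (simp add: nat_pow_inv)
  then show "inv a \<in> (\<lambda>x. x [^] k) ` carrier G" using x by blast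
next
  fix a b assume "a \<in> (\<lambda>x. x [^] k) ` carrier G" "b \<in> (\<lambda>x. x [^] k) ` carrier G"
  then obtain x y where x: "x \<in> carrier G" "a = x [^] k" "y \<in> carrier G" "b = y [^] k" by blast
  then have "a \<otimes> b = (x \<otimes> y) [^] k" by (simp add: pow_mult_distrib m_comm)
  then show "a \<otimes> b \<in> (\<lambda>x. x [^] k) ` carrier G" using x by blast
qed auto

lemma card_le_card_image_mult:
  assumes "finite A" "\<And>y. y \<in> f ` A \<Longrightarrow> card {x \<in> A. f x = y} \<le> k"
  shows "card A \<le> card (f ` A) * k"
proof -
  have "card A = card (\<Union>y\<in>f ` A. {x \<in> A. f x = y})"
    by (rule arg_cong[of _ _ card]) auto
  also have "\<dots> \<le> (\<Sum>y\<in>f ` A. card {x \<in> A. f x = y})"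
    using assms(1) by (intro card_UN_le) simp
  also have "\<dots> \<le> card (f ` A) * k"
    using sum_bounded_above[of "f ` A" "\<lambda>y. card {x \<in> A. f x = y}" k] assms(2) by simp
  finally show ?thesis .
qed

text \<open>A fibre of the k-th power map is a translate of the set of k-th roots of unity, of which
  a field has at most k. In other words, the k-th powers have index at most k.\<close>

lemma (in field) order_le_card_powers_mult:
  assumes fin: "finite (carrier R)" and k: "(k::nat) > 0"
  shows "order (Multiplicative_Group.mult_of R) \<le> card ((\<lambda>x. x [^] k) ` (carrier R - {\<zero>})) * k"
  unfolding order_def Multiplicative_Group.carrier_mult_of
proof (rule card_le_card_image_mult)
  fix y assume "y \<in> (\<lambda>x. x [^] k) ` (carrier R - {\<zero>})"
  then obtain a where a: "a \<in> carrier R" "a \<noteq> \<zero>" "y = a [^] k" by auto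
  have aU: "a \<in> Units R" using a by (simp add: field_Units)
  have "card {x \<in> carrier R - {\<zero>}. x [^] k = y} \<le> card {x \<in> carrier R. x [^] k = \<one>}"
  proof (rule card_inj_on_le[where f = "\<lambda>x. inv a \<otimes> x"])
    show "inj_on (\<lambda>x. inv a \<otimes> x) {x \<in> carrier R - {\<zero>}. x [^] k = y}"
      using aU by (auto simp: inj_on_def Units_inv_Units intro: Units_l_cancel[THEN iffD1])
    have "(inv a \<otimes> x) [^] k = \<one>" if "x \<in> carrier R" "x [^] k = a [^] k" for x
    proof -
      have "(inv a \<otimes> x) [^] k = inv a [^] k \<otimes> a [^] k"
        using that aU by (simp add: nat_pow_distrib)
      also have "\<dots> = (inv a \<otimes> a) [^] k"
        using a aU by (simp only: nat_pow_distrib Units_inv_closed)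
      finally show ?thesis using aU by simp
    qed
    then show "(\<lambda>x. inv a \<otimes> x) ` {x \<in> carrier R - {\<zero>}. x [^] k = y} \<subseteq> {x \<in> carrier R. x [^] k = \<one>}"
      using aU a by auto
  qed (use fin in simp)
  also have "\<dots> \<le> k"
    using num_roots_le_deg[OF fin, of k] k by simp
  finally show "card {x \<in> carrier R - {\<zero>}. x [^] k = y} \<le> k" .
qed (use fin in simp)

text \<open>A d-th power with d \<noteq> 1 is a p-th power for each prime p dividing d. As x is
  nonzero, so is the root, and the condition can be read inside the multiplicative group.\<close>

lemma (in field) r_free_iff_primes:
  assumes "x \<in> carrier R - {\<zero>}" "r > 0"
  shows "r_free R r x \<longleftrightarrow> (\<forall>p\<in>prime_factors r. x \<notin> (\<lambda>y. y [^] p) ` (carrier R - {\<zero>}))"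
proof
  assume free: "r_free R r x"
  show "\<forall>p\<in>prime_factors r. x \<notin> (\<lambda>y. y [^] p) ` (carrier R - {\<zero>})"
  proof (intro ballI notI)
    fix p assume "p \<in> prime_factors r" "x \<in> (\<lambda>y. y [^] p) ` (carrier R - {\<zero>})"
    then have "p dvd r" "prime p" "\<exists>y\<in>carrier R. x = y [^] p" by (auto simp: prime_factors_dvd)
    then show False using free unfolding r_free_def by (metis not_prime_1)
  qed
next
  assume *: "\<forall>p\<in>prime_factors r. x \<notin> (\<lambda>y. y [^] p) ` (carrier R - {\<zero>})"
  show "r_free R r x"
    unfolding r_free_def
  proof (intro allI ballI impI, rule ccontr)
    fix d :: nat and y assume y: "y \<in> carrier R" and d: "d dvd r \<and> x = y [^] d" and "d \<noteq> 1"
    then obtain p where p: "prime p" "p dvd d" using prime_factor_nat by blast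
    then obtain k where k: "d = k * p" by (metis dvdE mult.commute)
    have "x = (y [^] k) [^] p" using d k y by (simp add: nat_pow_pow)
    moreover from this have "y [^] k \<noteq> \<zero>"
      using assms p prime_gt_0_nat[of p] by (auto simp: nat_pow_zero)
    moreover have "p \<in> prime_factors r"
      using p d assms by (auto simp: prime_factors_dvd intro: dvd_trans)
    ultimately show False using * y by blast
  qed
qed

lemma of_bool_ball_eq_prod:
  "finite I \<Longrightarrow> of_bool (\<forall>i\<in>I. Q i) = (\<Prod>i\<in>I. of_bool (Q i) :: 'b :: comm_semiring_1)"
proof (induction I rule: finite_induct)
  case (insert i I)
  have "of_bool (\<forall>j\<in>insert i I. Q j) = (of_bool (Q i) * of_bool (\<forall>j\<in>I. Q j) :: 'b)" by simp
  with insert show ?case by simp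
qed simp

text \<open>The prime p serves twice: it kills the quotient by the p-th powers, which supplies the
  characters, and it bounds the order of this quotient, which gives the constant.\<close>

lemma (in field) fourier_bound_r_free:
  assumes fin: "finite (carrier R)" and r: "r > 0"
  shows "fourier_bound (Multiplicative_Group.mult_of R) (\<lambda>x. of_bool (r_free R r x)) (\<Prod>p\<in>prime_factors r. 2 * (1 - 1 / real p))"
proof -
  interpret M: comm_group "Multiplicative_Group.mult_of R" by (rule comm_group_mult_of)
  let ?H = "\<lambda>p. (\<lambda>y. y [^] p) ` (carrier R - {\<zero>})"
  have "fourier_bound (Multiplicative_Group.mult_of R) (\<lambda>x. \<Prod>p\<in>prime_factors r. of_bool (x \<notin> ?H p)) (\<Prod>p\<in>prime_factors r. 2 * (1 - 1 / real p))"
  proof (rule fourier_bound_prod)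
    fix p assume "p \<in> prime_factors r"
    then have p: "prime p" by auto
    show "fourier_bound (Multiplicative_Group.mult_of R) (\<lambda>x. of_bool (x \<notin> ?H p)) (2 * (1 - 1 / real p))"
    proof (rule M.fourier_bound_compl_subgroup[OF _ p])
      show "subgroup (?H p) (Multiplicative_Group.mult_of R)"
        using M.subgroup_pow_image[of p] by (simp add: Multiplicative_Group.nat_pow_mult_of)
      show "order (Multiplicative_Group.mult_of R) \<le> card (?H p) * p"
        using order_le_card_powers_mult[OF fin] p prime_gt_0_nat by blast
    qed (use fin in \<open>auto simp: Multiplicative_Group.nat_pow_mult_of\<close>)
  qed simp
  then show ?thesis
  proof (rule fourier_bound.weaken)
    fix x assume "x \<in> carrier (Multiplicative_Group.mult_of R)"
    then have "r_free R r x \<longleftrightarrow> (\<forall>p\<in>prime_factors r. x \<notin> ?H p)"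
      using r_free_iff_primes[of x r] r by simp
    then show "of_bool (r_free R r x) = (\<Prod>p\<in>prime_factors r. of_bool (x \<notin> ?H p) :: complex)"
      by (simp only: of_bool_ball_eq_prod[OF finite_set_mset])
  qed simp
qed

text \<open>Coprimality to r has period r, so each block of r consecutive integers contributes
  \<open>totient r\<close>.\<close>

lemma card_coprime_lessThan_multiple:
  assumes "(r::nat) > 0"
  shows "card {i \<in> {..<r * k}. coprime i r} = k * totient r"
proof (induction k)
  case (Suc k)
  have cop: "coprime (r * k + i) r \<longleftrightarrow> coprime i r" for i
    by (metis coprime_iff_gcd_eq_1 gcd.commute gcd_add_mult mult.commute)
  have "{i \<in> {..<r * Suc k}. coprime i r} = {i \<in> {..<r * k}. coprime i r} \<union> (\<lambda>i. r * k + i) ` {i \<in> {..<r}. coprime i r}"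
  proof (intro Set.set_eqI iffI)
    fix i assume i: "i \<in> {i \<in> {..<r * Suc k}. coprime i r}"
    show "i \<in> {i \<in> {..<r * k}. coprime i r} \<union> (\<lambda>i. r * k + i) ` {i \<in> {..<r}. coprime i r}"
    proof (cases "i < r * k")
      case False
      then have e: "i = r * k + (i - r * k)" by simp
      then have "coprime (r * k + (i - r * k)) r" using i by simp
      then have "coprime (i - r * k) r" by (simp only: cop)
      moreover have "i - r * k < r" using i False by auto
      ultimately show ?thesis using e by blast
    qed (use i in auto)
  next
    fix i assume "i \<in> {i \<in> {..<r * k}. coprime i r} \<union> (\<lambda>i. r * k + i) ` {i \<in> {..<r}. coprime i r}"
    then show "i \<in> {i \<in> {..<r * Suc k}. coprime i r}"
      by (auto simp: cop)
  qed
  moreover have "card ((\<lambda>i. r * k + i) ` {i \<in> {..<r}. coprime i r}) = totient r"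
  proof -
    have "card ((\<lambda>i. r * k + i) ` {i \<in> {..<r}. coprime i r}) = card {i \<in> {..<r}. coprime i r}"
      by (rule card_image) (auto simp: inj_on_def)
    \<comment> \<open>Residues run from 0 to r - 1 but \<open>totatives\<close> from 1 to r; the
      sets differ only for r = 1, where 0 takes the place of 1.\<close>
    also have "\<dots> = card (if r = 1 then {0} else totatives r)"
      using assms by (intro arg_cong[of _ _ card])
        (auto simp: totatives_def intro: Nat.gr0I order.not_eq_order_implies_strict)
    also have "\<dots> = totient r"
      by (simp add: totient_def)
    finally show ?thesis .
  qed
  moreover have "{i \<in> {..<r * k}. coprime i r} \<inter> (\<lambda>i. r * k + i) ` {i \<in> {..<r}. coprime i r} = {}"
    by auto
  ultimately show ?case
    using Suc by (simp add: card_Un_disjoint)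
qed simp

lemma (in field) obtain_generator:
  assumes fin: "finite (carrier R)"
  defines "N \<equiv> order (Multiplicative_Group.mult_of R)"
  obtains g where "g \<in> carrier (Multiplicative_Group.mult_of R)"
    "carrier (Multiplicative_Group.mult_of R) = {g [^]\<^bsub>R\<^esub> i | i::nat. i \<in> UNIV}"
    "group.ord (Multiplicative_Group.mult_of R) g = N" "inj_on (\<lambda>i. g [^]\<^bsub>R\<^esub> i) {..<N}" "N > 0"
proof -
  interpret M: group "Multiplicative_Group.mult_of R" by (rule field_mult_group)
  have N0: "N > 0" using fin by (simp add: N_def M.order_gt_0_iff_finite)
  obtain g where g: "g \<in> carrier (Multiplicative_Group.mult_of R)"
      "carrier (Multiplicative_Group.mult_of R) = {g [^]\<^bsub>R\<^esub> i | i::nat. i \<in> UNIV}"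
    using finite_field_mult_group_has_gen[OF fin] by blast
  have fin': "finite (carrier (Multiplicative_Group.mult_of R))" using fin by simp
  have ord: "M.ord g = N"
    using M.generate_pow_card[OF g(1)] M.generate_pow_on_finite_carrier[OF fin' g(1)] g(2)
    by (simp add: N_def order_def Multiplicative_Group.nat_pow_mult_of)
  have "inj_on (\<lambda>i. g [^] i) {..<N}"
    using M.ord_inj[OF g(1)] N0 ord
    by (simp add: Multiplicative_Group.nat_pow_mult_of atLeast0AtMost lessThan_Suc_atMost[symmetric])
  then show ?thesis using that g ord N0 by blast
qed

text \<open>For a generator g, \<open>g [^] i\<close> is a p-th power exactly when p divides i,
  because p divides the order of g. Freeness of \<open>g [^] i\<close> thus means that i is coprime
  to r.\<close>

lemma (in field) card_r_free:
  assumes fin: "finite (carrier R)" and r: "r dvd order R - 1"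
  shows "real (card {x \<in> carrier R - {\<zero>}. r_free R r x}) = theta r * real (card (carrier R - {\<zero>}))"
proof -
  interpret M: group "Multiplicative_Group.mult_of R" by (rule field_mult_group)
  let ?N = "order (Multiplicative_Group.mult_of R)"
  have N: "?N = card (carrier R - {\<zero>})" by (simp add: order_def)
  obtain g where g: "g \<in> carrier (Multiplicative_Group.mult_of R)"
      "carrier (Multiplicative_Group.mult_of R) = {g [^]\<^bsub>R\<^esub> i | i::nat. i \<in> UNIV}"
    and ord: "M.ord g = ?N" and inj: "inj_on (\<lambda>i. g [^]\<^bsub>R\<^esub> i) {..<?N}" and N0: "?N > 0"
    using fin by (rule obtain_generator)
  have gc: "g \<in> carrier R" "g \<noteq> \<zero>" using g by auto
  have rN: "r dvd ?N" using r fin by (simp add: order_mult_of)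
  have r0: "r > 0" using rN N0 by (metis dvd_pos_nat)
  have free: "r_free R r (g [^] i) \<longleftrightarrow> coprime i r" for i :: nat
  proof -
    have pdvd: "g [^] i \<in> (\<lambda>y. y [^] p) ` (carrier R - {\<zero>}) \<longleftrightarrow> p dvd i" if p: "p dvd r" for p
    proof
      assume "g [^] i \<in> (\<lambda>y. y [^] p) ` (carrier R - {\<zero>})"
      then obtain j :: nat where "g [^] i = (g [^] j) [^] p"
        using g(2) by auto
      then have "g [^] i = g [^] (j * p)" using gc by (simp add: nat_pow_pow)
      \<comment> \<open>Equal powers of g have exponents congruent modulo \<open>?N\<close> only;
        divisibility by p survives because p divides r and r divides \<open>?N\<close>.\<close>
      then have "int ?N dvd (int (j * p) - int i)"
        using M.int_pow_eq[OF g(1), of "int i" "int (j * p)"] ord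
        by (simp add: int_pow_int Multiplicative_Group.nat_pow_mult_of del: of_nat_mult)
      then have "int p dvd (int (j * p) - int i)"
        using p rN by (meson dvd_trans int_dvd_int_iff)
      then have "int p dvd int i"
        by (metis dvd_diffD dvd_diff_commute dvd_triv_right int_dvd_int_iff dvd_diff_right_iff)
      then show "p dvd i" by simp
    next
      assume "p dvd i"
      then obtain j where "i = j * p" by (metis dvdE mult.commute)
      then have "g [^] i = (g [^] j) [^] p" using gc by (simp add: nat_pow_pow)
      moreover have "g [^] j \<in> carrier R - {\<zero>}"
        using g(2) by auto
      ultimately show "g [^] i \<in> (\<lambda>y. y [^] p) ` (carrier R - {\<zero>})" by blast
    qed
    have "g [^] i \<in> carrier R - {\<zero>}" using g(2) by auto
    then have "r_free R r (g [^] i) \<longleftrightarrow> (\<forall>p\<in>prime_factors r. \<not> p dvd i)"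
      using r_free_iff_primes[of "g [^] i" r] r0 pdvd by (auto simp: prime_factors_dvd)
    also have "\<dots> \<longleftrightarrow> coprime i r"
    proof
      assume *: "\<forall>p\<in>prime_factors r. \<not> p dvd i"
      show "coprime i r"
      proof (rule ccontr)
        assume "\<not> coprime i r"
        then obtain p where "prime p" "p dvd i" "p dvd r"
          by (metis coprime_iff_gcd_eq_1 gcd_dvd1 gcd_dvd2 prime_factor_nat dvd_trans)
        then show False using * r0 by (auto simp: prime_factors_dvd)
      qed
    next
      assume "coprime i r"
      then show "\<forall>p\<in>prime_factors r. \<not> p dvd i"
        by (metis coprime_common_divisor_nat in_prime_factors_iff not_prime_1)
    qed
    finally show ?thesis .
  qed
  have "(\<lambda>i. g [^] i) ` {..<?N} = carrier R - {\<zero>}"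
  proof (rule card_subset_eq)
    show "(\<lambda>i. g [^] i) ` {..<?N} \<subseteq> carrier R - {\<zero>}" using g(2) by auto
    show "card ((\<lambda>i. g [^] i) ` {..<?N}) = card (carrier R - {\<zero>})"
      using card_image[OF inj] N by simp
  qed (use fin in simp)
  then have "{x \<in> carrier R - {\<zero>}. r_free R r x} = {x \<in> (\<lambda>i. g [^] i) ` {..<?N}. r_free R r x}"
    by simp
  also have "\<dots> = (\<lambda>i. g [^] i) ` {i \<in> {..<?N}. coprime i r}"
    by (auto simp: free)
  also have "card \<dots> = card {i \<in> {..<?N}. coprime i r}"
    by (rule card_image) (rule inj_on_subset[OF inj], auto)
  also have "\<dots> = (?N div r) * totient r"
    using card_coprime_lessThan_multiple[OF r0, of "?N div r"] rN by simp
  finally have "real (card {x \<in> carrier R - {\<zero>}. r_free R r x}) = real (?N div r) * real (totient r)"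
    by simp
  also have "real (?N div r) = real ?N / real r"
    using rN by (simp add: real_of_nat_div)
  finally show ?thesis
    by (simp add: theta_def N)
qed

text \<open>Euler's product turns the left side into 2^k \<theta>(r), where k is the number of prime
  factors of r. Distinct sets of prime factors have distinct products, so r has at least 2^k
  divisors.\<close>

lemma W_theta_ge:
  assumes "r > 0"
  shows "(\<Prod>p\<in>prime_factors r. 2 * (1 - 1 / real p)) \<le> real (W r) * theta r"
proof -
  have "2 ^ card (prime_factors r) = card (Pow (prime_factors r))"
    by (simp add: card_Pow)
  also have "\<dots> \<le> card {d. d dvd r}"
  proof (rule card_inj_on_le)
    have *: "p \<in> S \<longleftrightarrow> prime p \<and> p dvd \<Prod>S" if "S \<subseteq> prime_factors r" for p S
    proof -
      have "finite S" using that by (rule finite_subset) simp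
      then show ?thesis
        using that by (auto simp: prime_dvd_prod_iff dvd_prodI intro: primes_dvd_imp_eq)
          (metis in_mono in_prime_factors_imp_prime primes_dvd_imp_eq)
    qed
    show "inj_on (\<lambda>S. \<Prod>S) (Pow (prime_factors r))"
      by (rule inj_onI) (metis * PowD subsetI subset_antisym)
    show "(\<lambda>S. \<Prod>S) ` Pow (prime_factors r) \<subseteq> {d. d dvd r}"
    proof safe
      fix S assume S: "S \<subseteq> prime_factors r"
      have "\<Prod>S dvd (\<Prod>p\<in>prime_factors r. p)"
        using S by (intro prod_dvd_prod_subset) auto
      also have "\<dots> dvd (\<Prod>p\<in>prime_factors r. p ^ multiplicity p r)"
        by (intro prod_dvd_prod) (auto simp: prime_factors_multiplicity dvd_power)
      also have "\<dots> = r"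
        using assms prime_factorization_nat[of r] by simp
      finally show "\<Prod>S dvd r" .
    qed
    show "finite {d. d dvd r}"
      using assms by simp
  qed
  finally have "2 ^ card (prime_factors r) \<le> real (W r)"
    by (simp add: W_def flip: of_nat_le_iff)
  moreover have "theta r = (\<Prod>p\<in>prime_factors r. 1 - 1 / real p)"
    using assms by (simp add: theta_def totient_formula2)
  moreover have "theta r \<ge> 0"
    by (simp add: theta_def)
  ultimately show ?thesis
    by (simp only: prod.distrib prod_constant) (simp add: mult_right_mono)
qed

section \<open>Subfields of a finite field\<close>

lemma (in cring) binomial_theorem:
  assumes x: "x \<in> carrier R" and y: "y \<in> carrier R"
  shows "(x \<oplus> y) [^] (n::nat) = (\<Oplus>i\<in>{..n}. [(n choose i)] \<cdot> (x [^] i \<otimes> y [^] (n - i)))"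
proof (induction n)
  case (Suc n)
  let ?t = "\<lambda>n i. [(n choose i)] \<cdot> (x [^] i \<otimes> y [^] (n - i))"
  have tc: "?t n i \<in> carrier R" for n i
    using x y by simp
  have step: "?t (Suc n) (Suc i) = x \<otimes> ?t n i \<oplus> y \<otimes> ?t n (Suc i)" if "i \<in> {..n}" for i
  proof -
    have "x \<otimes> ?t n i = [(n choose i)] \<cdot> (x [^] Suc i \<otimes> y [^] (n - i))"
      using x y by (simp add: add_pow_rdistr m_ac)
    moreover have "y \<otimes> ?t n (Suc i) = [(n choose Suc i)] \<cdot> (x [^] Suc i \<otimes> y [^] (n - i))"
    proof (cases "i < n")
      case True
      then have "n - i = Suc (n - Suc i)" by simp
      then show ?thesis using x y by (simp add: add_pow_rdistr m_ac)
    next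
      case False
      \<comment> \<open>Here i = n, and the vanishing coefficient hides the truncated subtraction in
        \<open>n - Suc i\<close>.\<close>
      then have "n choose Suc i = 0" by simp
      then show ?thesis using x y by (simp only: add.nat_pow_0 r_null)
    qed
    ultimately show ?thesis
      using x y by (simp add: add.nat_pow_mult)
  qed
  have "(\<Oplus>i\<in>{..Suc n}. ?t (Suc n) i) = (\<Oplus>i\<in>{..n}. ?t (Suc n) (Suc i)) \<oplus> ?t (Suc n) 0"
    by (rule finsum_Suc2) (use tc in blast)
  also have "(\<Oplus>i\<in>{..n}. ?t (Suc n) (Suc i)) = (\<Oplus>i\<in>{..n}. x \<otimes> ?t n i \<oplus> y \<otimes> ?t n (Suc i))"
    by (rule finsum_cong') (use step tc x y in auto)
  also have "\<dots> = (\<Oplus>i\<in>{..n}. x \<otimes> ?t n i) \<oplus> (\<Oplus>i\<in>{..n}. y \<otimes> ?t n (Suc i))"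
    by (rule finsum_addf) (use tc x y in auto)
  also have "(\<Oplus>i\<in>{..n}. x \<otimes> ?t n i) = x \<otimes> (\<Oplus>i\<in>{..n}. ?t n i)"
    by (rule finsum_rdistr[symmetric]) (use tc x in auto)
  also have "?t (Suc n) 0 = y \<otimes> ?t n 0"
    using x y by (simp add: m_comm)
  finally have "(\<Oplus>i\<in>{..Suc n}. ?t (Suc n) i)
      = x \<otimes> (\<Oplus>i\<in>{..n}. ?t n i) \<oplus> ((\<Oplus>i\<in>{..n}. y \<otimes> ?t n (Suc i)) \<oplus> y \<otimes> ?t n 0)"
    using x y tc by (simp add: a_assoc Pi_def)
  also have "(\<Oplus>i\<in>{..n}. y \<otimes> ?t n (Suc i)) \<oplus> y \<otimes> ?t n 0 = (\<Oplus>i\<in>{..Suc n}. y \<otimes> ?t n i)"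
    by (rule finsum_Suc2[symmetric]) (use tc y in blast)
  also have "\<dots> = y \<otimes> ?t n (Suc n) \<oplus> (\<Oplus>i\<in>{..n}. y \<otimes> ?t n i)"
    by (rule finsum_Suc) (use tc y in blast)
  also have "(\<Oplus>i\<in>{..n}. y \<otimes> ?t n i) = y \<otimes> (\<Oplus>i\<in>{..n}. ?t n i)"
    by (rule finsum_rdistr[symmetric]) (use tc y in auto)
  also have "?t n (Suc n) = \<zero>"
    by (simp only: binomial_eq_0[OF lessI] add.nat_pow_0)
  finally show ?case
    using x y Suc tc by (simp add: r_distr l_distr m_comm Pi_def)
qed (use x y in simp)

lemma (in cring) frobenius_prime:
  assumes p: "prime (p::nat)" and char: "[p] \<cdot> \<one> = \<zero>" and x: "x \<in> carrier R" and y: "y \<in> carrier R"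
  shows "(x \<oplus> y) [^] p = x [^] p \<oplus> y [^] p"
proof -
  let ?t = "\<lambda>i. [(p choose i)] \<cdot> (x [^] i \<otimes> y [^] (p - i))"
  have tc: "?t i \<in> carrier R" for i
    using x y by simp
  have char0: "[p] \<cdot> z = \<zero>" if "z \<in> carrier R" for z
    using add_pow_ldistr[of \<one> z p] char that by simp
  have zero: "?t (Suc i) = \<zero>" if "Suc i < p" for i
  proof -
    have "p dvd (p choose Suc i)"
      using p that by (intro dvd_choose_prime) auto
    then obtain k where "p choose Suc i = p * k" by blast
    then have "?t (Suc i) = [p] \<cdot> ([k] \<cdot> (x [^] Suc i \<otimes> y [^] (p - Suc i)))"
      using x y by (simp add: add.nat_pow_pow mult.commute del: nat_pow_Suc)
    then show ?thesis
      using x y char0 by simp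
  qed
  obtain n where n: "p = Suc (Suc n)"
    using prime_ge_2_nat[OF p] by (metis Suc_diff_Suc add_2_eq_Suc le_add_diff_inverse)
  have "(x \<oplus> y) [^] p = (\<Oplus>i\<in>{..p}. ?t i)"
    using x y by (rule binomial_theorem)
  also have "\<dots> = ?t p \<oplus> (\<Oplus>i\<in>{..Suc n}. ?t i)"
    unfolding n by (rule finsum_Suc) (use tc[unfolded n] in blast)
  also have "(\<Oplus>i\<in>{..Suc n}. ?t i) = (\<Oplus>i\<in>{..n}. ?t (Suc i)) \<oplus> ?t 0"
    by (rule finsum_Suc2) (use tc in blast)
  also have "(\<Oplus>i\<in>{..n}. ?t (Suc i)) = (\<Oplus>i\<in>{..n}. \<zero>)"
    by (rule finsum_cong') (use zero n in auto)
  finally show ?thesis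
    using x y by simp
qed

lemma (in cring) frobenius_prime_power:
  assumes p: "prime (p::nat)" and char: "[p] \<cdot> \<one> = \<zero>" and x: "x \<in> carrier R" and y: "y \<in> carrier R"
  shows "(x \<oplus> y) [^] (p ^ k) = x [^] (p ^ k) \<oplus> y [^] (p ^ k)"
proof (induction k)
  case (Suc k)
  have "(x \<oplus> y) [^] (p ^ Suc k) = ((x \<oplus> y) [^] (p ^ k)) [^] p"
    using x y by (simp add: nat_pow_pow mult.commute)
  also have "\<dots> = (x [^] (p ^ k)) [^] p \<oplus> (y [^] (p ^ k)) [^] p"
    unfolding Suc using x y frobenius_prime[OF p char] by simp
  finally show ?case
    using x y by (simp add: nat_pow_pow mult.commute)
qed (use x y in simp)

text \<open>The multiple of \<one> by p^k is zero by Lagrange, and it is the k-th power of the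
  multiple by p; a domain has no nonzero nilpotents.\<close>

lemma (in domain) char_of_prime_power_order:
  assumes "order R = p ^ k" "(p::nat) > 0"
  shows "[p] \<cdot> \<one> = \<zero>"
proof -
  have "\<one> [^]\<^bsub>add_monoid R\<^esub> order (add_monoid R) = \<one>\<^bsub>add_monoid R\<^esub>"
    by (rule group.pow_order_eq_1[OF add.is_group]) simp
  then have "[(p ^ k)] \<cdot> \<one> = \<zero>"
    using assms by (simp add: order_def add_pow_def)
  moreover have "[(p ^ k)] \<cdot> \<one> = ([p] \<cdot> \<one>) [^] k"
  proof (induction k)
    case (Suc k)
    have "[(p ^ Suc k)] \<cdot> \<one> = [p] \<cdot> ([(p ^ k)] \<cdot> \<one>)"
      by (simp add: add.nat_pow_pow mult.commute)
    also have "\<dots> = ([(p ^ k)] \<cdot> \<one>) \<otimes> ([p] \<cdot> \<one>)"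
      by (simp add: add_pow_rdistr)
    finally show ?case using Suc by simp
  qed simp
  moreover have "a [^] k \<noteq> \<zero>" if "a \<in> carrier R" "a \<noteq> \<zero>" for a
    using that by (induction k) (auto simp: integral_iff)
  ultimately show ?thesis
    by (metis add.nat_pow_closed one_closed)
qed

lemma (in field) finite_subfield_pow_card:
  assumes "subfield K R" "finite K" "x \<in> K"
  shows "x [^] card K = x"
proof (cases "x = \<zero>")
  case True
  have "card K > 0" using assms by (auto simp: card_gt_0_iff)
  then show ?thesis using True by (simp add: nat_pow_zero)
next
  case False
  interpret K: field "R\<lparr>carrier := K\<rparr>"
    by (rule subfield_iff(2)[OF assms(1)])
  have "x [^]\<^bsub>Multiplicative_Group.mult_of (R\<lparr>carrier := K\<rparr>)\<^esub> order (Multiplicative_Group.mult_of (R\<lparr>carrier := K\<rparr>))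
      = \<one>\<^bsub>Multiplicative_Group.mult_of (R\<lparr>carrier := K\<rparr>)\<^esub>"
    using assms False by (intro group.pow_order_eq_1[OF K.field_mult_group]) simp
  moreover have "order (Multiplicative_Group.mult_of (R\<lparr>carrier := K\<rparr>)) = card K - 1"
    using K.order_mult_of assms by (simp add: order_def)
  ultimately have "x [^]\<^bsub>R\<lparr>carrier := K\<rparr>\<^esub> (card K - 1) = \<one>"
    by (simp add: Multiplicative_Group.nat_pow_mult_of)
  then have "x [^] (card K - 1) = \<one>"
    by (simp add: nat_pow_def)
  moreover have "x [^] Suc (card K - 1) = x [^] (card K - 1) \<otimes> x" by simp
  moreover have "card K > 0" "x \<in> carrier R" using assms subfieldE(3) by (auto simp: card_gt_0_iff)
  ultimately show ?thesis by simp
qed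

text \<open>At most d by counting polynomial roots. At least d because, when the multiplicative
  group has order d k, the powers \<open>g [^] (k * i)\<close> of a generator with i < d are
  distinct roots.\<close>

lemma (in field) card_roots_of_unity:
  assumes fin: "finite (carrier R)" and d: "d dvd order R - 1" "d > 0"
  shows "card {x \<in> carrier R. x [^] d = \<one>} = d"
proof (rule antisym)
  show "card {x \<in> carrier R. x [^] d = \<one>} \<le> d"
    using num_roots_le_deg[OF fin] d by simp
  interpret M: group "Multiplicative_Group.mult_of R" by (rule field_mult_group)
  let ?N = "order (Multiplicative_Group.mult_of R)"
  obtain g where g: "g \<in> carrier (Multiplicative_Group.mult_of R)"
      "carrier (Multiplicative_Group.mult_of R) = {g [^]\<^bsub>R\<^esub> i | i::nat. i \<in> UNIV}"
    and ord: "M.ord g = ?N" and inj: "inj_on (\<lambda>i. g [^]\<^bsub>R\<^esub> i) {..<?N}" and N0: "?N > 0"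
    using fin by (rule obtain_generator)
  have gc: "g \<in> carrier R" using g by auto
  obtain k where k: "?N = d * k"
    using d fin by (auto simp: order_mult_of)
  have k0: "k > 0" using k N0 by (cases k) auto
  have "inj_on (\<lambda>i. g [^] (k * i)) {..<d}"
  proof (rule inj_onI)
    fix i j assume ij: "i \<in> {..<d}" "j \<in> {..<d}" "g [^] (k * i) = g [^] (k * j)"
    then have "k * i = k * j"
      using k k0 by (intro inj_onD[OF inj ij(3)]) (simp_all add: mult.commute)
    then show "i = j" using k0 by simp
  qed
  then have "d = card ((\<lambda>i. g [^] (k * i)) ` {..<d})"
    by (simp add: card_image)
  also have "\<dots> \<le> card {x \<in> carrier R. x [^] d = \<one>}"
  proof (rule card_mono)
    have "(g [^] (k * i)) [^] d = \<one>" for i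
    proof -
      have "(g [^] (k * i)) [^] d = (g [^] ?N) [^] i"
        using gc k by (simp add: nat_pow_pow mult_ac)
      also have "g [^] ?N = \<one>"
        using M.pow_order_eq_1[OF g(1)] by (simp add: Multiplicative_Group.nat_pow_mult_of)
      finally show ?thesis by simp
    qed
    then show "(\<lambda>i. g [^] (k * i)) ` {..<d} \<subseteq> {x \<in> carrier R. x [^] d = \<one>}"
      using gc by auto
  qed (use fin in simp)
  finally show "d \<le> card {x \<in> carrier R. x [^] d = \<one>}" .
qed

lemma dvd_power_minus_one:
  assumes "l dvd n"
  shows "(q::nat) ^ l - 1 dvd q ^ n - 1"
proof -
  obtain m where "n = l * m" using assms by blast
  have "int (q ^ l) - 1 dvd int (q ^ l) ^ m - 1"
    using power_diff_1_eq[of "int (q ^ l)" m] by simp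
  then show ?thesis
  proof (cases "q = 0")
    case False
    then have "int (q ^ l - 1) = int (q ^ l) - 1" "int (q ^ n - 1) = int (q ^ l) ^ m - 1"
      using \<open>n = l * m\<close> by (simp_all add: of_nat_diff power_mult)
    then show ?thesis
      using \<open>int (q ^ l) - 1 dvd int (q ^ l) ^ m - 1\<close> by (metis int_dvd_int_iff)
  qed (use assms in \<open>auto simp: power_0_left\<close>)
qed

locale finite_field = field R for R (structure) +
  fixes q n :: nat
  assumes primepow_q: "primepow q" and n_pos: "n > 0" and order_eq: "order R = q ^ n"
begin

lemma q_gt_1: "q > 1"
  using primepow_gt_Suc_0[OF primepow_q] by simp

lemma finite_carrier: "finite (carrier R)"
  by (rule card_ge_0_finite) (use order_eq q_gt_1 in \<open>simp add: order_def\<close>)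

lemma obtains_char:
  obtains p e where "prime p" "q = p ^ e" "[p] \<cdot> \<one> = \<zero>"
proof -
  obtain p e where p: "prime p" "q = p ^ e"
    using primepow_q by (auto simp: primepow_def)
  then have "order R = p ^ (e * n)"
    by (simp add: order_eq power_mult)
  then show ?thesis
    using that p char_of_prime_power_order prime_gt_0_nat by blast
qed

lemma frobenius_add:
  assumes "x \<in> carrier R" "y \<in> carrier R"
  shows "(x \<oplus> y) [^] (q ^ l) = x [^] (q ^ l) \<oplus> y [^] (q ^ l)"
proof -
  obtain p e where p: "prime p" "q = p ^ e" "[p] \<cdot> \<one> = \<zero>"
    by (rule obtains_char)
  then show ?thesis
    using frobenius_prime_power[OF p(1,3) assms, of "e * l"] by (simp add: power_mult)
qed

text \<open>Additivity of the Frobenius map makes its fixed points a subfield. They are \<zero> and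
  the roots of unity of order dividing q^l - 1; this number divides q^n - 1, so all of them are
  present.\<close>

lemma subfield_fixed_points:
  assumes l: "l dvd n"
  defines "K \<equiv> {x \<in> carrier R. x [^] (q ^ l) = x}"
  shows "subfield K R" "card K = q ^ l"
proof -
  let ?Q = "q ^ l"
  have "l > 0" using l n_pos by (auto intro: Nat.gr0I)
  then have Q: "?Q > 1" using q_gt_1 one_less_power by blast
  then have SQ: "Suc (?Q - 1) = ?Q" by simp
  have zeroQ: "\<zero> [^] ?Q = \<zero>"
    using Q by (intro nat_pow_zero) linarith
  show "subfield K R"
  proof (rule subfieldI')
    show "subring K R"
    proof (rule subringI)
      fix h assume h: "h \<in> K"
      have "(\<ominus> h \<oplus> h) [^] ?Q = (\<ominus> h) [^] ?Q \<oplus> h [^] ?Q"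
        using h by (intro frobenius_add) (auto simp: K_def)
      then have "(\<ominus> h) [^] ?Q \<oplus> h = \<zero>"
        using h zeroQ by (simp add: K_def l_neg)
      then have "(\<ominus> h) [^] ?Q = \<ominus> h"
        using h by (intro minus_equality[symmetric]) (auto simp: K_def)
      then show "\<ominus> h \<in> K" using h by (auto simp: K_def)
    qed (auto simp: K_def frobenius_add nat_pow_distrib)
    fix k assume k: "k \<in> K - {\<zero>}"
    then have kU: "k \<in> Units R" by (auto simp: K_def field_Units)
    have "(inv k) [^] ?Q \<otimes> k = \<one>"
    proof -
      have "(inv k) [^] ?Q \<otimes> k [^] ?Q = (inv k \<otimes> k) [^] ?Q"
        using kU by (simp only: nat_pow_distrib Units_inv_closed Units_closed)
      then show ?thesis using k kU by (auto simp: K_def)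
    qed
    then have "inv k = (inv k) [^] ?Q"
      using kU by (intro comm_inv_char) (auto simp: m_comm Units_closed)
    then show "inv k \<in> K" using kU by (simp add: K_def)
  qed
  have "K = insert \<zero> {x \<in> carrier R. x [^] (?Q - 1) = \<one>}"
  proof (intro Set.set_eqI iffI)
    fix x assume x: "x \<in> K"
    show "x \<in> insert \<zero> {x \<in> carrier R. x [^] (?Q - 1) = \<one>}"
    proof (cases "x = \<zero>")
      case False
      have "x [^] Suc (?Q - 1) = x" unfolding SQ using x by (simp add: K_def)
      then have "x [^] (?Q - 1) \<otimes> x = \<one> \<otimes> x" using x by (simp add: K_def)
      then show ?thesis using x False by (subst (asm) m_rcancel) (auto simp: K_def)
    qed simp
  next
    fix x assume "x \<in> insert \<zero> {x \<in> carrier R. x [^] (?Q - 1) = \<one>}"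
    then consider "x = \<zero>" | "x \<in> carrier R" "x [^] (?Q - 1) = \<one>" by auto
    then show "x \<in> K"
    proof cases
      case 2
      then have "x [^] Suc (?Q - 1) = x" by simp
      then show ?thesis unfolding SQ using 2 by (simp add: K_def)
    qed (simp add: K_def zeroQ)
  qed
  moreover have "card {x \<in> carrier R. x [^] (?Q - 1) = \<one>} = ?Q - 1"
    using finite_carrier Q dvd_power_minus_one[OF l] by (intro card_roots_of_unity) (auto simp: order_eq)
  moreover have "\<zero> \<notin> {x \<in> carrier R. x [^] (?Q - 1) = \<one>}"
    using Q by (simp add: nat_pow_zero)
  ultimately show "card K = ?Q"
    using finite_carrier Q by simp
qed

text \<open>A subfield of this size consists of fixed points by Lagrange and equals their set by
  cardinality. This uniqueness gives the definite description in \<open>GFsub\<close> its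
  meaning.\<close>

lemma GFsub_eq:
  assumes l: "l dvd n"
  shows "GFsub R q l = {x \<in> carrier R. x [^] (q ^ l) = x}" (is "_ = ?K")
  unfolding GFsub_def
proof (rule the_equality)
  show "subfield ?K R \<and> card ?K = q ^ l"
    using subfield_fixed_points[OF l] by simp
  fix L assume L: "subfield L R \<and> card L = q ^ l"
  then have "L \<subseteq> carrier R" using subfieldE(3) by blast
  then have "finite L" using finite_carrier by (rule finite_subset)
  have "L \<subseteq> ?K"
  proof
    fix x assume x: "x \<in> L"
    then have "x \<in> carrier R" using \<open>L \<subseteq> carrier R\<close> by (rule rev_subsetD)
    then show "x \<in> ?K"
      using finite_subfield_pow_card[of L x] x L \<open>finite L\<close> by simp
  qed
  then show "L = ?K"
    using L subfield_fixed_points[OF l] finite_carrier by (intro card_subset_eq) auto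
qed

lemma
  assumes l: "l dvd n"
  shows subfield_GFsub: "subfield (GFsub R q l) R" and card_GFsub: "card (GFsub R q l) = q ^ l"
  using subfield_fixed_points[OF l] by (simp_all add: GFsub_eq[OF l])

end

section \<open>Frobenius action and normal elements\<close>

text \<open>The situation at a single divisor l, later instantiated with Q = q^l and m = n div l.
  Additivity of Q-th powers is taken as an assumption and supplied there by
  \<open>frobenius_add\<close>.\<close>

locale frobenius_action = field R for R (structure) +
  fixes K :: "'a set" and Q m :: nat
  assumes subfield_K: "subfield K R" and finite_K: "finite K" and card_K: "card K = Q"
    and m_pos: "m > 0" and order_R: "order R = Q ^ m"
    and pow_Q_add: "\<And>x y. x \<in> carrier R \<Longrightarrow> y \<in> carrier R \<Longrightarrow> (x \<oplus> y) [^] Q = x [^] Q \<oplus> y [^] Q"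
begin

lemma subring_K: "subring K R"
  using subfieldE(1)[OF subfield_K] .

lemma K_carrier: "k \<in> K \<Longrightarrow> k \<in> carrier R"
  using subfieldE(3)[OF subfield_K] by (rule subsetD)

lemma set_carrier: "set p \<subseteq> K \<Longrightarrow> set p \<subseteq> carrier R"
  using K_carrier by auto

lemma Q_gt_1: "Q > 1"
proof -
  have "card {\<zero>, \<one>} \<le> card K"
    using subringE(2,3)[OF subring_K] finite_K by (intro card_mono) auto
  then show ?thesis using card_K by simp
qed

lemma finite_R: "finite (carrier R)"
  by (rule card_ge_0_finite) (use order_R Q_gt_1 in \<open>simp add: order_def\<close>)

lemma pow_Q_pow_add:
  "x \<in> carrier R \<Longrightarrow> y \<in> carrier R \<Longrightarrow> (x \<oplus> y) [^] (Q ^ i) = x [^] (Q ^ i) \<oplus> y [^] (Q ^ i)"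
  by (induction i) (simp_all add: nat_pow_pow[symmetric] mult.commute[of Q] pow_Q_add)

lemma zero_pow_Q_pow: "\<zero> [^] (Q ^ i) = \<zero>"
proof -
  have "Q ^ i \<noteq> 0" using Q_gt_1 by simp
  then show ?thesis by (rule nat_pow_zero)
qed

lemma K_pow_Q_pow: "k \<in> K \<Longrightarrow> k [^] (Q ^ i) = k"
  using finite_subfield_pow_card[OF subfield_K finite_K, of k] K_carrier[of k]
  by (induction i) (simp_all add: nat_pow_pow[symmetric] mult.commute[of Q] card_K)

lemma pow_Q_pow_m: "x \<in> carrier R \<Longrightarrow> x [^] (Q ^ m) = x"
  using finite_subfield_pow_card[OF carrier_is_subfield finite_R] order_R by (simp add: order_def)

text \<open>\<open>act p x\<close> is \<open>p(\<sigma>)(x)\<close> for the Frobenius map \<open>\<sigma> = (\<lambda>x. x ^ Q)\<close> of \<open>R\<close> over \<open>K\<close>.\<close>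

fun act :: "'a list \<Rightarrow> 'a \<Rightarrow> 'a" where
  "act [] x = \<zero>"
| "act (a # p) x = a \<otimes> x [^] (Q ^ length p) \<oplus> act p x"

lemma act_closed [simp]: "set p \<subseteq> K \<Longrightarrow> x \<in> carrier R \<Longrightarrow> act p x \<in> carrier R"
  by (induction p) (auto intro: K_carrier)

lemma act_add:
  assumes "set p \<subseteq> K" "x \<in> carrier R" "y \<in> carrier R"
  shows "act p (x \<oplus> y) = act p x \<oplus> act p y"
  using assms
proof (induction p)
  case (Cons a p)
  then have "a \<in> carrier R" "act p x \<in> carrier R" "act p y \<in> carrier R"
    by (auto intro: K_carrier)
  with Cons show ?case
    by (simp add: pow_Q_pow_add r_distr a_ac)
qed simp

lemma act_zero: "set p \<subseteq> K \<Longrightarrow> act p \<zero> = \<zero>"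
  by (induction p) (auto simp: zero_pow_Q_pow K_carrier)

lemma act_pow:
  assumes "set p \<subseteq> K" "x \<in> carrier R"
  shows "act p (x [^] (Q ^ i)) = act p x [^] (Q ^ i)"
  using assms
proof (induction p)
  case (Cons a p)
  then have a: "a \<in> K" "a \<in> carrier R" "act p x \<in> carrier R"
    by (auto intro: K_carrier)
  have "act (a # p) x [^] (Q ^ i) = (a \<otimes> x [^] (Q ^ length p)) [^] (Q ^ i) \<oplus> act p x [^] (Q ^ i)"
    using a Cons.prems by (simp add: pow_Q_pow_add)
  also have "(a \<otimes> x [^] (Q ^ length p)) [^] (Q ^ i) = a \<otimes> (x [^] (Q ^ i)) [^] (Q ^ length p)"
    using a Cons.prems by (simp add: nat_pow_distrib K_pow_Q_pow nat_pow_pow mult.commute)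
  finally show ?case using Cons by simp
qed (simp add: zero_pow_Q_pow)

lemma act_replicate_zero: "x \<in> carrier R \<Longrightarrow> set p \<subseteq> K \<Longrightarrow> act (replicate i \<zero> @ p) x = act p x"
  by (induction i) simp_all

lemma act_normalize: "x \<in> carrier R \<Longrightarrow> set p \<subseteq> K \<Longrightarrow> act (normalize p) x = act p x"
  by (induction p) auto

lemma act_map2_add:
  assumes "length p = length r" "x \<in> carrier R" "set p \<subseteq> K" "set r \<subseteq> K"
  shows "act (map2 (\<oplus>) p r) x = act p x \<oplus> act r x"
  using assms
proof (induction p r rule: list_induct2)
  case (Cons a p b r)
  then have "a \<in> carrier R" "b \<in> carrier R" "act p x \<in> carrier R" "act r x \<in> carrier R"
    by (auto intro: K_carrier)
  with Cons show ?case
    by (simp add: l_distr a_ac)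
qed simp

lemma set_map2_add: "set p \<subseteq> K \<Longrightarrow> set r \<subseteq> K \<Longrightarrow> set (map2 (\<oplus>) p r) \<subseteq> K"
  using subringE(7)[OF subring_K] by (auto dest!: set_zip_leftD set_zip_rightD elim!: in_set_zipE)

lemma act_poly_add:
  assumes "set p \<subseteq> K" "set r \<subseteq> K" "x \<in> carrier R"
  shows "act (poly_add p r) x = act p x \<oplus> act r x"
proof -
  have *: "act (poly_add p r) x = act p x \<oplus> act r x"
    if "set p \<subseteq> K" "set r \<subseteq> K" "length r \<le> length p" for p r
  proof -
    let ?r = "replicate (length p - length r) \<zero> @ r"
    have r: "set ?r \<subseteq> K"
      using that subringE(2)[OF subring_K] by auto
    have "act (poly_add p r) x = act (map2 (\<oplus>) p ?r) x"
      using that assms(3) set_map2_add[OF that(1) r] by (simp add: act_normalize)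
    also have "\<dots> = act p x \<oplus> act ?r x"
      using that r assms(3) by (intro act_map2_add) auto
    finally show ?thesis
      using that assms(3) by (simp add: act_replicate_zero)
  qed
  show ?thesis
  proof (cases "length r \<le> length p")
    case False
    then have "poly_add p r = poly_add r p" by simp
    then show ?thesis
      using *[of r p] False assms by (simp add: a_comm del: poly_add.simps)
  qed (use * assms in blast)
qed

lemma act_smult_shift:
  assumes "a \<in> K" "set p \<subseteq> K" "x \<in> carrier R"
  shows "act (map ((\<otimes>) a) p @ replicate i \<zero>) x = a \<otimes> act p x [^] (Q ^ i)"
proof -
  have z: "act (replicate i \<zero>) x = \<zero>" for i
    using act_replicate_zero[OF assms(3), of "[]" i] by simp
  have "act (map ((\<otimes>) a) p @ replicate i \<zero>) x = a \<otimes> act p (x [^] (Q ^ i))"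
    using assms(2)
  proof (induction p)
    case Nil
    then show ?case using K_carrier[OF assms(1)] by (simp add: z)
  next
    case (Cons b p)
    then have "b \<in> carrier R" "act p (x [^] (Q ^ i)) \<in> carrier R" "a \<in> carrier R"
      using assms by (auto intro: K_carrier)
    with Cons show ?case
      using assms(3) by (simp add: r_distr m_assoc nat_pow_pow power_add mult.commute)
  qed
  then show ?thesis
    using assms by (simp add: act_pow)
qed

text \<open>The map \<sigma> fixes the coefficients, so products of polynomials act by composition.
  With \<open>act_poly_add\<close> this makes R a module over K[X].\<close>

lemma act_poly_mult:
  assumes "set p \<subseteq> K" "set r \<subseteq> K" "x \<in> carrier R"
  shows "act (poly_mult p r) x = act p (act r x)"
  using assms(1)
proof (induction p)
  case (Cons a p)
  have s: "set (map ((\<otimes>) a) r @ replicate (length p) \<zero>) \<subseteq> K"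
    using Cons.prems assms subringE(2,6)[OF subring_K] by auto
  have t: "set (poly_mult p r) \<subseteq> K"
    using poly_mult_is_polynomial[OF subring_K] Cons.prems assms polynomial_incl by auto
  have "act (poly_mult (a # p) r) x = act (map ((\<otimes>) a) r @ replicate (length p) \<zero>) x \<oplus> act (poly_mult p r) x"
    using act_poly_add[OF s t assms(3)] by (simp del: poly_add.simps)
  also have "\<dots> = a \<otimes> act r x [^] (Q ^ length p) \<oplus> act p (act r x)"
    using Cons act_smult_shift[of a r x "length p"] assms by simp
  finally show ?case by simp
qed simp

lemma poly_set: "p \<in> carrier (K[X]) \<Longrightarrow> set p \<subseteq> K"
  using polynomial_incl univ_poly_carrier by blast

lemma act_mult:
  "p \<in> carrier (K[X]) \<Longrightarrow> r \<in> carrier (K[X]) \<Longrightarrow> x \<in> carrier R \<Longrightarrow> act (p \<otimes>\<^bsub>K[X]\<^esub> r) x = act p (act r x)"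
  by (simp add: univ_poly_mult act_poly_mult poly_set)

lemma act_plus:
  "p \<in> carrier (K[X]) \<Longrightarrow> r \<in> carrier (K[X]) \<Longrightarrow> x \<in> carrier R \<Longrightarrow> act (p \<oplus>\<^bsub>K[X]\<^esub> r) x = act p x \<oplus> act r x"
  by (simp add: univ_poly_add act_poly_add poly_set del: poly_add.simps)

sublocale UP: principal_domain "K[X]"
  by (rule univ_poly_is_principal[OF subfield_K])

lemma act_uminus:
  assumes "p \<in> carrier (K[X])" "x \<in> carrier R"
  shows "act (\<ominus>\<^bsub>K[X]\<^esub> p) x = \<ominus> act p x"
proof -
  have "act (\<ominus>\<^bsub>K[X]\<^esub> p) x \<oplus> act p x = act (\<ominus>\<^bsub>K[X]\<^esub> p \<oplus>\<^bsub>K[X]\<^esub> p) x"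
    using assms by (simp add: act_plus)
  also have "\<dots> = \<zero>"
    using assms by (simp add: UP.l_neg univ_poly_zero)
  finally show ?thesis
    using assms poly_set by (intro minus_equality[symmetric]) (auto intro!: act_closed UP.a_inv_closed)
qed

lemma subgroup_act_kernel:
  assumes "set p \<subseteq> K"
  shows "subgroup {x \<in> carrier R. act p x = \<zero>} (add_monoid R)"
proof (rule add.subgroupI)
  show "{x \<in> carrier R. act p x = \<zero>} \<noteq> {}"
    using act_zero[OF assms] by blast
next
  fix x assume x: "x \<in> {x \<in> carrier R. act p x = \<zero>}"
  have "act p (\<ominus> x \<oplus> x) = act p (\<ominus> x) \<oplus> act p x"
    using x assms by (intro act_add) auto
  then have "act p (\<ominus> x) = \<zero>"
    using x assms by (simp add: l_neg act_zero)
  then show "\<ominus> x \<in> {x \<in> carrier R. act p x = \<zero>}"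
    using x by simp
qed (auto simp: act_add assms)

text \<open>The \<open>Q\<close>-linearized polynomial with coefficients \<open>p\<close>, whose values are given by \<open>act p\<close>.\<close>

fun linearized :: "'a list \<Rightarrow> 'a list" where
  "linearized [] = []"
| "linearized [a] = [a, \<zero>]"
| "linearized (a # b # p) = a # replicate (Q ^ Suc (length p) - Q ^ length p - 1) \<zero> @ linearized (b # p)"

text \<open>The gap between the exponents Q^(k+1) and Q^k is filled by Q^(k+1) - Q^k - 1 zeros. The
  constant \<open>[a]\<close> becomes a X, because Q^0 = 1.\<close>

lemma length_linearized: "p \<noteq> [] \<Longrightarrow> length (linearized p) = Suc (Q ^ degree p)"
proof (induction p rule: linearized.induct)
  case (3 a b p)
  have "Q ^ length p < Q ^ Suc (length p)"
    using Q_gt_1 by simp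
  with 3 show ?case by (simp del: power_Suc)
qed simp_all

lemma set_linearized: "set p \<subseteq> K \<Longrightarrow> set (linearized p) \<subseteq> carrier R"
  by (induction p rule: linearized.induct) (auto intro: K_carrier)

lemma eval_linearized: "set p \<subseteq> K \<Longrightarrow> x \<in> carrier R \<Longrightarrow> eval (linearized p) x = act p x"
proof (induction p rule: linearized.induct)
  case (2 a)
  then show ?case using K_carrier[of a] by simp
next
  case (3 a b p)
  have "Q ^ length p < Q ^ Suc (length p)"
    using Q_gt_1 by simp
  then have "length (linearized (a # b # p)) = Suc (Q ^ Suc (length p))"
    using length_linearized[of "a # b # p"] by simp
  then have "eval (linearized (a # b # p)) x
      = a \<otimes> x [^] (Q ^ Suc (length p)) \<oplus> eval (replicate (Q ^ Suc (length p) - Q ^ length p - 1) \<zero> @ linearized (b # p)) x"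
    by simp
  also have "eval (replicate (Q ^ Suc (length p) - Q ^ length p - 1) \<zero> @ linearized (b # p)) x = act (b # p) x"
    using 3 set_linearized[of "b # p"] eval_replicate by simp
  finally show ?case by simp
qed simp

text \<open>The kernel is the root set of a nonzero ordinary polynomial of degree
  \<open>Q ^ degree p\<close>.\<close>

lemma card_act_kernel:
  assumes p: "p \<in> carrier (K[X])" "p \<noteq> []"
  shows "card {x \<in> carrier R. act p x = \<zero>} \<le> Q ^ degree p"
proof -
  have sp: "set p \<subseteq> K" using p by (simp add: poly_set)
  have ne: "linearized p \<noteq> []" using p by (cases p rule: linearized.cases) auto
  have "hd (linearized p) = hd p" using p by (cases p rule: linearized.cases) auto
  moreover have "hd p \<noteq> \<zero>" using p by (auto simp: univ_poly_carrier[symmetric] polynomial_def)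
  ultimately have lin: "linearized p \<in> carrier (poly_ring R)"
    using set_linearized[OF sp] by (simp add: univ_poly_carrier[symmetric] polynomial_def)
  have "{x \<in> carrier R. act p x = \<zero>} = set_mset (roots (linearized p))"
    using roots_mem_iff_is_root[OF lin] eval_linearized[OF sp] ne by (auto simp: is_root_def)
  then have "card {x \<in> carrier R. act p x = \<zero>} \<le> size (roots (linearized p))"
    by (simp only: size_multiset_overloaded_eq card_eq_sum) (rule sum_mono, simp)
  also have "\<dots> \<le> degree (linearized p)"
    by (rule size_roots_le_degree[OF lin])
  finally show ?thesis
    using length_linearized[OF p(2)] by simp
qed

lemma order_le_card_act_image:
  assumes p: "p \<in> carrier (K[X])" "p \<noteq> []"
  shows "order R \<le> card (act p ` carrier R) * Q ^ degree p"
  unfolding order_def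
proof (rule card_le_card_image_mult[OF finite_R])
  fix y assume "y \<in> act p ` carrier R"
  then obtain a where a: "a \<in> carrier R" "y = act p a" by blast
  have sp: "set p \<subseteq> K" using p by (simp add: poly_set)
  have "card {x \<in> carrier R. act p x = y} \<le> card {x \<in> carrier R. act p x = \<zero>}"
  proof (rule card_inj_on_le[where f = "\<lambda>x. x \<oplus> \<ominus> a"])
    show "inj_on (\<lambda>x. x \<oplus> \<ominus> a) {x \<in> carrier R. act p x = y}"
      using a by (auto simp: inj_on_def)
    have "act p (x \<oplus> \<ominus> a) = \<zero>" if "x \<in> carrier R" "act p x = act p a" for x
    proof -
      have "act p (x \<oplus> \<ominus> a) = act p (a \<oplus> \<ominus> a)"
        using that a sp by (simp only: act_add a_inv_closed)
      then show ?thesis using a sp by (simp add: r_neg act_zero)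
    qed
    then show "(\<lambda>x. x \<oplus> \<ominus> a) ` {x \<in> carrier R. act p x = y} \<subseteq> {x \<in> carrier R. act p x = \<zero>}"
      using a by auto
  qed (use finite_R in simp)
  also have "\<dots> \<le> Q ^ degree p"
    by (rule card_act_kernel[OF p])
  finally show "card {x \<in> carrier R. act p x = y} \<le> Q ^ degree p" .
qed

section \<open>The polynomial X^m - 1 and its irreducible factors\<close>

definition F :: "'a list" where "F = X_pow_minus_1 R K m"

lemma
  shows F_closed: "F \<in> carrier (K[X])" and degree_F: "degree F = m" and F_ne: "F \<noteq> []"
    and act_F: "x \<in> carrier R \<Longrightarrow> act F x = \<zero>"
proof -
  have Xc: "X [^]\<^bsub>K[X]\<^esub> m \<in> carrier (K[X])"
    by (rule var_pow_closed[OF subring_K])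
  have mon: "X [^]\<^bsub>K[X]\<^esub> m = monom \<one> m"
    by (rule unitary_monom_eq_var_pow[OF subring_K, symmetric])
  have F: "F = X [^]\<^bsub>K[X]\<^esub> m \<oplus>\<^bsub>K[X]\<^esub> (\<ominus>\<^bsub>K[X]\<^esub> \<one>\<^bsub>K[X]\<^esub>)"
    by (simp add: F_def X_pow_minus_1_def a_minus_def)
  show "F \<in> carrier (K[X])"
    using Xc by (simp add: F)
  have "length (\<ominus>\<^bsub>K[X]\<^esub> \<one>\<^bsub>K[X]\<^esub>) = length \<one>\<^bsub>K[X]\<^esub>"
    using univ_poly_a_inv_length[OF subring_K UP.one_closed] .
  then have len1: "length (\<ominus>\<^bsub>K[X]\<^esub> \<one>\<^bsub>K[X]\<^esub>) = 1"
    by (simp add: univ_poly_one)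
  have "degree F = max (degree (X [^]\<^bsub>K[X]\<^esub> m)) (degree (\<ominus>\<^bsub>K[X]\<^esub> \<one>\<^bsub>K[X]\<^esub>))"
    unfolding F univ_poly_add
    by (rule poly_add_degree_eq[OF subring_K])
       (use Xc UP.a_inv_closed[OF UP.one_closed] len1 m_pos in \<open>simp_all add: univ_poly_carrier mon monom_def\<close>)
  then show "degree F = m"
    using len1 by (simp add: mon monom_def)
  then show "F \<noteq> []" using m_pos by auto
  show "act F x = \<zero>" if x: "x \<in> carrier R"
  proof -
    have "act (replicate m \<zero>) x = \<zero>"
      using act_replicate_zero[OF x, of "[]" m] by simp
    then have "act (X [^]\<^bsub>K[X]\<^esub> m) x = x"
      using x by (simp add: mon monom_def pow_Q_pow_m)
    moreover have "act (\<ominus>\<^bsub>K[X]\<^esub> \<one>\<^bsub>K[X]\<^esub>) x = \<ominus> x"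
      using x by (simp add: act_uminus) (simp add: univ_poly_one)
    ultimately show ?thesis
      using x Xc by (simp add: F act_plus r_neg)
  qed
qed

definition Irr :: "'a list set"
  where "Irr = {P. monic_in R K P \<and> pirreducible\<^bsub>R\<^esub> K P \<and> P divides\<^bsub>K[X]\<^bsub>R\<^esub>\<^esub> F}"

lemma IrrD:
  assumes "P \<in> Irr"
  shows "P \<in> carrier (K[X])" "P \<noteq> []" "pirreducible K P" "degree P \<ge> 1"
  using assms pirreducible_degree[OF subfield_K] by (auto simp: Irr_def monic_in_def)

text \<open>The quotient F/P. Divisibility supplies mere existence, hence the choice; for P in
  \<open>Irr\<close> it is unique by cancellation.\<close>

definition cofactor :: "'a list \<Rightarrow> 'a list"
  where "cofactor P = (SOME G. G \<in> carrier (K[X]) \<and> F = P \<otimes>\<^bsub>K[X]\<^esub> G)"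

lemma cofactor:
  assumes "P \<in> Irr"
  shows "cofactor P \<in> carrier (K[X])" "F = P \<otimes>\<^bsub>K[X]\<^esub> cofactor P"
proof -
  have "\<exists>G. G \<in> carrier (K[X]) \<and> F = P \<otimes>\<^bsub>K[X]\<^esub> G"
    using assms by (auto simp: Irr_def factor_def)
  from someI_ex[OF this] show "cofactor P \<in> carrier (K[X])" "F = P \<otimes>\<^bsub>K[X]\<^esub> cofactor P"
    by (simp_all add: cofactor_def)
qed

lemma divides_mult_right: "b \<in> carrier (K[X]) \<Longrightarrow> a divides\<^bsub>K[X]\<^esub> a \<otimes>\<^bsub>K[X]\<^esub> b"
  unfolding factor_def by blast

lemma degree_mult:
  assumes "p \<in> carrier (K[X])" "r \<in> carrier (K[X])" "p \<noteq> []" "r \<noteq> []"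
  shows "degree (p \<otimes>\<^bsub>K[X]\<^esub> r) = degree p + degree r"
  using poly_mult_degree_eq[OF subring_K, of p r] assms by (simp add: univ_poly_mult univ_poly_carrier)

lemma mult_ne:
  assumes "p \<in> carrier (K[X])" "r \<in> carrier (K[X])" "p \<otimes>\<^bsub>K[X]\<^esub> r \<noteq> []"
  shows "p \<noteq> []" "r \<noteq> []"
  using assms UP.l_null[of r] UP.r_null[of p] by (auto simp: univ_poly_zero)

definition H :: "'a list \<Rightarrow> 'a set"
  where "H P = {x \<in> carrier R. act (cofactor P) x = \<zero>}"

lemma subgroup_H: "P \<in> Irr \<Longrightarrow> subgroup (H P) (add_monoid R)"
  unfolding H_def using cofactor poly_set by (intro subgroup_act_kernel) auto

text \<open>Since F(\<sigma>) = 0, the image of P(\<sigma>) lies in the kernel of (F/P)(\<sigma>),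
  and the bound on the kernel of P(\<sigma>) makes this image large.\<close>

lemma order_le_card_H:
  assumes P: "P \<in> Irr"
  shows "order R \<le> card (H P) * Q ^ degree P"
proof -
  note [simp] = IrrD(1)[OF P] cofactor(1)[OF P]
  have "order R \<le> card (act P ` carrier R) * Q ^ degree P"
    using IrrD[OF P] by (intro order_le_card_act_image) auto
  also have "act P ` carrier R \<subseteq> H P"
  proof safe
    fix x assume x: "x \<in> carrier R"
    have "act (cofactor P) (act P x) = act (cofactor P \<otimes>\<^bsub>K[X]\<^esub> P) x"
      using x by (simp add: act_mult)
    also have "cofactor P \<otimes>\<^bsub>K[X]\<^esub> P = F"
      using cofactor(2)[OF P] by (simp add: UP.m_comm)
    finally show "act P x \<in> H P"
      using x by (simp add: act_F H_def poly_set)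
  qed
  then have "card (act P ` carrier R) * Q ^ degree P \<le> card (H P) * Q ^ degree P"
    using finite_R by (intro mult_right_mono card_mono) (auto simp: H_def)
  finally show ?thesis .
qed

section \<open>Dependence of conjugates and annihilating polynomials\<close>

definition conj_list :: "'a \<Rightarrow> 'a list"
  where "conj_list x = map (\<lambda>i. x [^] (Q ^ i)) [0..<m]"

text \<open>\<open>combine\<close> meets the exponents in ascending order, whereas polynomials start
  with the leading coefficient; hence the reversal.\<close>

lemma act_rev:
  assumes "set Ks \<subseteq> K" "x \<in> carrier R"
  shows "act (rev Ks) x = combine Ks (map (\<lambda>i. x [^] (Q ^ i)) [0..<length Ks])"
  using assms(1)
proof (induction Ks rule: rev_induct)
  case (snoc k Ks)
  let ?U = "map (\<lambda>i. x [^] (Q ^ i)) [0..<length Ks]"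
  have U: "set ?U \<subseteq> carrier R" using assms by auto
  have k: "k \<in> carrier R" "set Ks \<subseteq> carrier R"
    using snoc.prems set_carrier[of Ks] by (auto intro: K_carrier)
  have "combine (Ks @ [k]) (?U @ [x [^] (Q ^ length Ks)])
      = combine Ks ?U \<oplus> combine [k] [x [^] (Q ^ length Ks)]"
    by (rule combine_append[symmetric]) (use U k assms in auto)
  then show ?case
    using snoc k assms combine_in_carrier[OF k(2) U] by (simp add: a_comm)
qed simp

text \<open>A dependence among the conjugates of x is a nonzero polynomial of degree below m
  annihilating x. Then the generator of the annihilator of x is a proper divisor of F and so divides
  F/P for some irreducible P. Conversely, F/P itself has degree below m.\<close>

lemma independent_conj_list_iff:
  assumes x: "x \<in> carrier R"
  shows "independent K (conj_list x) \<longleftrightarrow> (\<forall>P\<in>Irr. x \<notin> H P)"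
proof (intro iffI ballI notI)
  fix P assume ind: "independent K (conj_list x)" and P: "P \<in> Irr" and xH: "x \<in> H P"
  define G where "G = cofactor P"
  have Gc: "G \<in> carrier (K[X])" using cofactor(1)[OF P] by (simp add: G_def)
  have G0: "act G x = \<zero>" using xH by (simp add: H_def G_def)
  have ne: "G \<noteq> []"
    using mult_ne(2)[OF IrrD(1)[OF P] Gc] cofactor(2)[OF P] F_ne by (simp add: G_def)
  have "degree P + degree G = m"
    using degree_mult[OF IrrD(1)[OF P] Gc IrrD(2)[OF P] ne] cofactor(2)[OF P] degree_F by (simp add: G_def)
  then have len: "length G \<le> m"
    using IrrD(4)[OF P] ne by (cases G) auto
  \<comment> \<open>The coefficients of F/P, padded by zeros at the high exponents to one
    coefficient per conjugate.\<close>
  define Ks where "Ks = rev G @ replicate (m - length G) \<zero>"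
  have Ks: "set Ks \<subseteq> K" "length Ks = m"
    using poly_set[OF Gc] subringE(2)[OF subring_K] len by (auto simp: Ks_def)
  have "combine Ks (conj_list x) = act (rev Ks) x"
    using act_rev[OF Ks(1) x] Ks(2) by (simp add: conj_list_def)
  also have "\<dots> = \<zero>"
    using act_replicate_zero[OF x poly_set[OF Gc]] G0 by (simp add: Ks_def)
  finally have "set (take (length (conj_list x)) Ks) \<subseteq> {\<zero>}"
    using independent_imp_trivial_combine[OF subfield_K ind Ks(1)] by simp
  then have "set Ks \<subseteq> {\<zero>}"
    using Ks(2) by (simp add: conj_list_def)
  moreover have "hd G \<in> set Ks" using ne by (simp add: Ks_def)
  moreover have "hd G \<noteq> \<zero>" using ne Gc by (auto simp: univ_poly_carrier[symmetric] polynomial_def)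
  ultimately show False by blast
next
  assume *: "\<forall>P\<in>Irr. x \<notin> H P"
  show "independent K (conj_list x)"
  proof (rule ccontr)
    assume dep: "dependent K (conj_list x)"
    have "set (conj_list x) \<subseteq> carrier R" using x by (auto simp: conj_list_def)
    from dependent_imp_non_trivial_combine[OF subfield_K this dep] obtain Ks where
      Ks: "length Ks = length (conj_list x)" "combine Ks (conj_list x) = \<zero>" "set Ks \<subseteq> K" "set Ks \<noteq> {\<zero>}"
      by blast
    then have lenK: "length Ks = m" by (simp add: conj_list_def)
    define C where "C = normalize (rev Ks)"
    have Cc: "C \<in> carrier (K[X])"
      using normalize_gives_polynomial[of "rev Ks" K] Ks by (simp add: C_def univ_poly_carrier)
    have Cne: "C \<noteq> []"
    proof
      assume "C = []"
      then have "rev Ks = replicate m \<zero>"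
        using normalize_trick[of "rev Ks"] lenK by (simp add: C_def)
      then have "set Ks = {\<zero>}" using m_pos by (metis set_replicate set_rev less_numeral_extra(3))
      then show False using Ks(4) by blast
    qed
    have lenC: "length C \<le> m"
      using normalize_length_le[of "rev Ks"] lenK by (simp add: C_def)
    have "act (rev Ks) x = \<zero>"
      using act_rev[OF Ks(3) x] Ks(2) lenK by (simp add: conj_list_def)
    then have C0: "act C x = \<zero>"
      using Ks(3) x by (simp add: C_def act_normalize)
    \<comment> \<open>The annihilator of x. It contains C and F, so its generator D divides
      both.\<close>
    define I where "I = {p \<in> carrier (K[X]). act p x = \<zero>}"
    have "ideal I (K[X])"
    proof (rule idealI[OF UP.ring_axioms])
      show "subgroup I (add_monoid (K[X]))"
      proof (rule UP.add.subgroupI)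
        have "\<zero>\<^bsub>K[X]\<^esub> \<in> I" by (simp add: I_def) (simp add: univ_poly_zero)
        then show "I \<noteq> {}" by blast
      qed (auto simp: I_def act_plus act_uminus x)
    next
      fix p r assume pr: "p \<in> I" "r \<in> carrier (K[X])"
      then show "r \<otimes>\<^bsub>K[X]\<^esub> p \<in> I"
        using x by (simp add: I_def act_mult act_zero poly_set)
      then show "p \<otimes>\<^bsub>K[X]\<^esub> r \<in> I"
        using pr by (simp add: I_def UP.m_comm)
    qed
    then obtain D where D: "D \<in> carrier (K[X])" "I = PIdl\<^bsub>K[X]\<^esub> D"
      using UP.exists_gen by blast
    have "D \<in> I" using D UP.cgenideal_self by blast
    then have D0: "act D x = \<zero>" by (simp add: I_def)
    have "C \<in> I" "F \<in> I" using Cc C0 F_closed act_F[OF x] by (simp_all add: I_def)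
    moreover have "D divides\<^bsub>K[X]\<^esub> p" if "p \<in> I" for p
    proof -
      have "p \<in> carrier (K[X])" using that by (simp add: I_def)
      moreover have "PIdl\<^bsub>K[X]\<^esub> p \<subseteq> PIdl\<^bsub>K[X]\<^esub> D"
        using UP.cgenideal_minimal[OF \<open>ideal I (K[X])\<close> that] by (simp add: D(2))
      ultimately show ?thesis
        using UP.to_contain_is_to_divide[OF D(1)] by blast
    qed
    ultimately have "D divides\<^bsub>K[X]\<^esub> C" "D divides\<^bsub>K[X]\<^esub> F"
      by simp_all
    then obtain B E where B: "B \<in> carrier (K[X])" "C = D \<otimes>\<^bsub>K[X]\<^esub> B"
      and E: "E \<in> carrier (K[X])" "F = D \<otimes>\<^bsub>K[X]\<^esub> E"
      by (auto simp: factor_def)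
    have ne: "D \<noteq> []" "B \<noteq> []" "E \<noteq> []"
      using mult_ne[OF D(1) B(1)] mult_ne[OF D(1) E(1)] B E Cne F_ne by auto
    have "degree C = degree D + degree B"
      using degree_mult[OF D(1) B(1) ne(1,2)] B by simp
    moreover have "degree C < m" using lenC Cne m_pos by (cases C) auto
    moreover have "m = degree D + degree E"
      using degree_mult[OF D(1) E(1) ne(1,3)] E degree_F by simp
    \<comment> \<open>The degree of D is at most that of C, hence below m: the complementary factor
      E of F is not constant and has an irreducible divisor.\<close>
    ultimately have "degree E > 0" by linarith
    then have nu: "E \<notin> Units (K[X])"
      using univ_poly_units'[OF subfield_K, of E] by simp
    have nz: "E \<in> carrier (K[X]) - {\<zero>\<^bsub>K[X]\<^esub>}"
      using E ne by (simp add: univ_poly_zero)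
    obtain P0 where P0: "P0 \<in> carrier (K[X])" "pirreducible K P0" "P0 divides\<^bsub>K[X]\<^esub> E"
      by (rule UP.exists_irreducible_divisor[OF nz nu])
    have "PIdl\<^bsub>K[X]\<^esub> P0 \<noteq> {[]}"
      using UP.cgenideal_self[OF P0(1)] pirreducibleE(1)[OF subring_K P0(1,2)] by auto
    \<comment> \<open>Passage to the monic associate, as a generator of the same ideal;
      irreducibility carries over because the quotient ring is the same.\<close>
    then obtain P where P: "P \<in> carrier (K[X])" "lead_coeff P = \<one>" "PIdl\<^bsub>K[X]\<^esub> P0 = PIdl\<^bsub>K[X]\<^esub> P"
      using ex1_implies_ex[OF exists_unique_gen[OF subfield_K UP.cgenideal_ideal[OF P0(1)]]] by auto
    have Pirr: "pirreducible K P"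
      using rupture_is_field_iff_pirreducible[OF subfield_K P0(1)]
        rupture_is_field_iff_pirreducible[OF subfield_K P(1)] P0(2) P(3) by (simp add: rupture_def)
    have "P divides\<^bsub>K[X]\<^esub> E"
      using P0(3) UP.to_contain_is_to_divide[OF P(1) E(1)] UP.to_contain_is_to_divide[OF P0(1) E(1)] P(3)
      by simp
    then obtain E' where E': "E' \<in> carrier (K[X])" "E = P \<otimes>\<^bsub>K[X]\<^esub> E'"
      by (auto simp: factor_def)
    have FP: "F = P \<otimes>\<^bsub>K[X]\<^esub> (D \<otimes>\<^bsub>K[X]\<^esub> E')"
      using E E' P D by (simp add: UP.m_ac)
    have PI: "P \<in> Irr"
      using P Pirr pirreducibleE(1)[OF subring_K P(1) Pirr] D E' divides_mult_right[of "D \<otimes>\<^bsub>K[X]\<^esub> E'" P]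
      by (simp add: Irr_def monic_in_def FP)
    have "P \<otimes>\<^bsub>K[X]\<^esub> cofactor P = P \<otimes>\<^bsub>K[X]\<^esub> (D \<otimes>\<^bsub>K[X]\<^esub> E')"
      using cofactor(2)[OF PI] FP by simp
    \<comment> \<open>The factor D survives in F/P, so F/P annihilates x as well.\<close>
    then have "cofactor P = E' \<otimes>\<^bsub>K[X]\<^esub> D"
      using UP.m_lcancel[of P "cofactor P" "D \<otimes>\<^bsub>K[X]\<^esub> E'"] cofactor(1)[OF PI] P(1) D E' IrrD(2)[OF PI]
      by (simp add: univ_poly_zero UP.m_comm)
    then have "act (cofactor P) x = \<zero>"
      using x D E' D0 by (simp add: act_mult act_zero poly_set)
    then show False using * PI x by (auto simp: H_def)
  qed
qed

text \<open>Independence makes the Q^m combinations distinct, and R has just Q^m elements.\<close>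

lemma independent_imp_Span_eq_carrier:
  assumes ind: "independent K Us" and len: "length Us = m"
  shows "Span K Us = carrier R"
proof (rule card_subset_eq[OF finite_R])
  have Us: "set Us \<subseteq> carrier R" by (rule independent_in_carrier[OF ind])
  then show "Span K Us \<subseteq> carrier R"
    using Span_in_carrier[OF subfieldE(3)[OF subfield_K]] by blast
  let ?L = "{Ks. set Ks \<subseteq> K \<and> length Ks = m}"
  have Span: "Span K Us = (\<lambda>Ks. combine Ks Us) ` ?L"
    using Span_eq_combine_set_length_version[OF subfield_K Us] len by auto
  have "inj_on (\<lambda>Ks. combine Ks Us) ?L"
  proof (rule inj_onI)
    fix Ks Ls assume *: "Ks \<in> ?L" "Ls \<in> ?L" "combine Ks Us = combine Ls Us"
    have "combine Ks Us \<in> Span K Us" using *(1) Span by blast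
    then show "Ks = Ls"
      using unique_decomposition[OF subfield_K ind, of "combine Ks Us"] * len by auto
  qed
  then have "card (Span K Us) = card ?L"
    by (simp only: Span card_image)
  also have "\<dots> = Q ^ m"
    using card_lists_length_eq[OF finite_K, of m] card_K by simp
  finally show "card (Span K Us) = card (carrier R)"
    using order_R by (simp add: order_def)
qed

end

section \<open>Counting units and monic divisors\<close>

lemma card_Units_le_of_ring_iso:
  assumes "ring A" "ring B" "h \<in> ring_iso A B" "finite (carrier A)"
  shows "card (Units B) \<le> card (Units A)"
proof -
  interpret A: ring A by fact
  interpret B: ring B by fact
  have hom: "h \<in> ring_hom A B" and bij: "bij_betw h (carrier A) (carrier B)"
    using assms(3) by (auto simp: ring_iso_def)
  have inj: "inj_on h (carrier A)" using bij by (rule bij_betw_imp_inj_on)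
  have "Units B \<subseteq> h ` Units A"
  proof
    fix u assume "u \<in> Units B"
    then obtain v where uv: "u \<in> carrier B" "v \<in> carrier B" "v \<otimes>\<^bsub>B\<^esub> u = \<one>\<^bsub>B\<^esub>" "u \<otimes>\<^bsub>B\<^esub> v = \<one>\<^bsub>B\<^esub>"
      unfolding Units_def by blast
    then obtain a b where ab: "a \<in> carrier A" "b \<in> carrier A" "u = h a" "v = h b"
      using bij unfolding bij_betw_def by blast
    have "h (b \<otimes>\<^bsub>A\<^esub> a) = h \<one>\<^bsub>A\<^esub>" "h (a \<otimes>\<^bsub>A\<^esub> b) = h \<one>\<^bsub>A\<^esub>"
      using uv ab ring_hom_memE(2,4)[OF hom] by simp_all
    then have "b \<otimes>\<^bsub>A\<^esub> a = \<one>\<^bsub>A\<^esub>" "a \<otimes>\<^bsub>A\<^esub> b = \<one>\<^bsub>A\<^esub>"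
      using ab by (auto intro: inj_onD[OF inj])
    then have "a \<in> Units A" using ab unfolding Units_def by blast
    then show "u \<in> h ` Units A" using ab by blast
  qed
  moreover have "finite (Units A)"
    using assms(4) by (rule rev_finite_subset) (auto simp: Units_def)
  ultimately show ?thesis
    by (meson card_image_le card_mono finite_imageI order_trans)
qed

lemma Units_RDirProd: "Units A \<times> Units B \<subseteq> Units (RDirProd A B)"
proof safe
  fix u v assume "u \<in> Units A" "v \<in> Units B"
  then obtain u' v' where
    "u \<in> carrier A" "u' \<in> carrier A" "u' \<otimes>\<^bsub>A\<^esub> u = \<one>\<^bsub>A\<^esub>" "u \<otimes>\<^bsub>A\<^esub> u' = \<one>\<^bsub>A\<^esub>"
    "v \<in> carrier B" "v' \<in> carrier B" "v' \<otimes>\<^bsub>B\<^esub> v = \<one>\<^bsub>B\<^esub>" "v \<otimes>\<^bsub>B\<^esub> v' = \<one>\<^bsub>B\<^esub>"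
    unfolding Units_def by blast
  then have "(u', v') \<in> carrier (RDirProd A B) \<and> (u, v) \<in> carrier (RDirProd A B) \<and>
     (u', v') \<otimes>\<^bsub>RDirProd A B\<^esub> (u, v) = \<one>\<^bsub>RDirProd A B\<^esub> \<and> (u, v) \<otimes>\<^bsub>RDirProd A B\<^esub> (u', v') = \<one>\<^bsub>RDirProd A B\<^esub>"
    by (simp add: RDirProd_def DirProd_def monoid.defs)
  then show "(u, v) \<in> Units (RDirProd A B)"
    unfolding Units_def by blast
qed

context frobenius_action
begin

lemma finite_bounded_polys: "finite {p \<in> carrier (K[X]). length p \<le> d}"
  by (rule finite_subset[OF _ finite_lists_length_le[OF finite_K, of d]]) (use poly_set in auto)

text \<open>Deleting leading zeros is injective on lists of fixed length d, since d tells how many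
  zeros were deleted.\<close>

lemma card_bounded_polys: "Q ^ d \<le> card {p \<in> carrier (K[X]). length p \<le> d}"
proof -
  let ?L = "{Ks. set Ks \<subseteq> K \<and> length Ks = d}"
  have "Q ^ d = card ?L"
    using card_lists_length_eq[OF finite_K, of d] card_K by simp
  also have "\<dots> \<le> card {p \<in> carrier (K[X]). length p \<le> d}"
  proof (rule card_inj_on_le[OF _ _ finite_bounded_polys])
    show "inj_on normalize ?L"
    proof (rule inj_onI)
      fix p r assume "p \<in> ?L" "r \<in> ?L" "normalize p = normalize r"
      then show "p = r" using normalize_trick[of p] normalize_trick[of r] by simp
    qed
    show "normalize ` ?L \<subseteq> {p \<in> carrier (K[X]). length p \<le> d}"
      using normalize_gives_polynomial[of _ K] normalize_length_le by (auto simp: univ_poly_carrier[symmetric])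
  qed
  finally show ?thesis .
qed

lemma finite_rupture:
  assumes "p \<in> carrier (K[X])" "p \<noteq> []"
  shows "finite (carrier (Rupt K p))"
  using finite_bounded_polys[of "degree p"]
  unfolding rupture_carrier_as_pmod_image[OF subfield_K assms(1), symmetric]
    pmod_image_characterization[OF subfield_K assms] by (rule finite_imageI)

lemma card_rupture:
  assumes "p \<in> carrier (K[X])" "p \<noteq> []"
  shows "Q ^ degree p \<le> card (carrier (Rupt K p))"
proof -
  have "card (carrier (Rupt K p)) = card {r \<in> carrier (K[X]). length r \<le> degree p}"
    using card_image[OF rupture_surj_inj_on[OF subfield_K assms(1)]]
      rupture_carrier_as_pmod_image[OF subfield_K assms(1)]
    unfolding pmod_image_characterization[OF subfield_K assms] by simp
  then show ?thesis using card_bounded_polys by simp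
qed

section \<open>Products of distinct irreducible factors\<close>

lemma monic_divides_irreducible_imp_eq:
  assumes P: "monic_in R K P" "pirreducible K P" and P': "monic_in R K P'" "pirreducible K P'"
    and dvd: "P divides\<^bsub>K[X]\<^esub> P'"
  shows "P = P'"
proof -
  have c: "P \<in> carrier (K[X])" "P' \<in> carrier (K[X])" "P \<noteq> []" "P' \<noteq> []" "hd P = \<one>" "hd P' = \<one>"
    using P P' by (auto simp: monic_in_def)
  have "P \<sim>\<^bsub>K[X]\<^esub> P'"
    using divides_pirreducible_condition[OF P'(2) c(1) dvd] pirreducibleE(2)[OF subring_K c(1) P(2)] by blast
  then obtain k where k: "k \<in> K - {\<zero>}" "P = [k] \<otimes>\<^bsub>K[X]\<^esub> P'"
    using associated_polynomials_iff[OF subfield_K c(1,2)] by blast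
  have "hd P = k \<otimes> hd P'"
    using poly_mult_lead_coeff[OF subring_K const_is_polynomial[OF k(1)], of P'] c k(2)
    by (simp add: univ_poly_mult univ_poly_carrier del: poly_mult.simps)
  then have "k = \<one>" using c k K_carrier by auto
  then show ?thesis using k c UP.l_one[of P'] by (simp add: univ_poly_one)
qed

lemma finite_Irr: "finite Irr"
proof (rule finite_subset[OF _ finite_bounded_polys[of "Suc m"]])
  show "Irr \<subseteq> {p \<in> carrier (K[X]). length p \<le> Suc m}"
  proof safe
    fix P assume P: "P \<in> Irr"
    then show "P \<in> carrier (K[X])" by (rule IrrD)
    have "degree P \<le> degree F"
      using pdivides_imp_degree_le[OF subring_K IrrD(1)[OF P] F_closed F_ne]
        pdivides_iff_shell[OF subfield_K IrrD(1)[OF P] F_closed] P by (simp add: Irr_def)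
    then show "length P \<le> Suc m" using degree_F by simp
  qed
qed

abbreviation prod_poly :: "'a list set \<Rightarrow> 'a list"
  where "prod_poly S \<equiv> finprod (K[X]) (\<lambda>P. P) S"

lemma prod_poly_insert:
  assumes "finite S" "P \<notin> S" "insert P S \<subseteq> Irr"
  shows "prod_poly (insert P S) = P \<otimes>\<^bsub>K[X]\<^esub> prod_poly S"
  using assms IrrD(1) by (intro UP.finprod_insert) auto

lemma prod_poly_props:
  assumes "finite S" "S \<subseteq> Irr"
  shows "monic_in R K (prod_poly S) \<and> degree (prod_poly S) = (\<Sum>P\<in>S. degree P)"
  using assms
proof (induction S rule: finite_induct)
  case empty
  have "polynomial K [\<one>]"
    using subringE(3)[OF subring_K] by (intro const_is_polynomial) simp
  then show ?case by (simp add: univ_poly_one monic_in_def univ_poly_carrier)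
next
  case (insert P S)
  let ?G = "prod_poly S"
  have P: "P \<in> carrier (K[X])" "P \<noteq> []" "hd P = \<one>"
    using insert.prems by (auto simp: Irr_def monic_in_def)
  have G: "?G \<in> carrier (K[X])" "?G \<noteq> []" "hd ?G = \<one>" "degree ?G = (\<Sum>P\<in>S. degree P)"
    using insert by (auto simp: monic_in_def)
  have e: "prod_poly (insert P S) = P \<otimes>\<^bsub>K[X]\<^esub> ?G"
    using insert by (intro prod_poly_insert) auto
  have "hd (P \<otimes>\<^bsub>K[X]\<^esub> ?G) = \<one>"
    using poly_mult_lead_coeff[OF subring_K, of P ?G] P G
    by (simp add: univ_poly_mult univ_poly_carrier del: poly_mult.simps)
  moreover have "P \<otimes>\<^bsub>K[X]\<^esub> ?G \<noteq> []"
    using UP.integral_iff[OF P(1) G(1)] P G by (simp add: univ_poly_zero)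
  ultimately show ?case
    using insert P G degree_mult[OF P(1) G(1) P(2) G(2)] unfolding e by (simp add: monic_in_def)
qed

lemma prod_poly_closed: "S \<subseteq> Irr \<Longrightarrow> prod_poly S \<in> carrier (K[X])"
  using IrrD(1) by (intro UP.finprod_closed) auto

lemma prod_poly_ne: "S \<subseteq> Irr \<Longrightarrow> prod_poly S \<noteq> []"
  using prod_poly_props[of S] finite_subset[OF _ finite_Irr] by (auto simp: monic_in_def)

lemma prime_divides_mult:
  assumes "P \<in> Irr" "a \<in> carrier (K[X])" "b \<in> carrier (K[X])" "P divides\<^bsub>K[X]\<^esub> a \<otimes>\<^bsub>K[X]\<^esub> b"
  shows "P divides\<^bsub>K[X]\<^esub> a \<or> P divides\<^bsub>K[X]\<^esub> b"
proof -
  have "pprime K P"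
    using pprime_iff_pirreducible[OF subfield_K] IrrD[OF assms(1)] by blast
  then show ?thesis
    using pprimeE(3)[OF subfield_K IrrD(1)[OF assms(1)] _ assms(2,3)] assms(2-4)
      pdivides_iff_shell[OF subfield_K IrrD(1)[OF assms(1)]] by simp
qed

text \<open>An irreducible P is prime, so it divides one factor, and monic irreducibles that divide
  one another coincide.\<close>

lemma Irr_divides_prod_poly:
  assumes "finite S" "S \<subseteq> Irr" "P \<in> Irr" "P divides\<^bsub>K[X]\<^esub> prod_poly S"
  shows "P \<in> S"
  using assms
proof (induction S rule: finite_induct)
  case empty
  then have "P divides\<^bsub>K[X]\<^esub> \<one>\<^bsub>K[X]\<^esub>" by simp
  then have "P \<in> Units (K[X])"
    using IrrD(1)[OF \<open>P \<in> Irr\<close>] UP.divides_one by simp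
  then show ?case
    using pirreducibleE(2)[OF subring_K IrrD(1,3)[OF \<open>P \<in> Irr\<close>]] by blast
next
  case (insert P' S)
  have "P divides\<^bsub>K[X]\<^esub> P' \<or> P divides\<^bsub>K[X]\<^esub> prod_poly S"
    using insert.prems insert.hyps prod_poly_insert[of S P']
    by (intro prime_divides_mult) (auto intro: IrrD prod_poly_closed)
  then show ?case
    using insert monic_divides_irreducible_imp_eq[of P P'] by (auto simp: Irr_def)
qed

text \<open>Each subset of \<open>Irr\<close> yields a monic divisor of the full product, and the
  subset is recovered as the members of \<open>Irr\<close> dividing it.\<close>

lemma W_poly_ge: "2 ^ card Irr \<le> W_poly R K (prod_poly Irr)"
proof -
  let ?D = "{D. monic_in R K D \<and> D divides\<^bsub>K[X]\<^esub> prod_poly Irr}"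
  have fin: "finite ?D"
  proof (rule finite_subset[OF _ finite_bounded_polys[of "length (prod_poly Irr)"]])
    show "?D \<subseteq> {p \<in> carrier (K[X]). length p \<le> length (prod_poly Irr)}"
    proof safe
      fix D assume D: "monic_in R K D" "D divides\<^bsub>K[X]\<^esub> prod_poly Irr"
      then show Dc: "D \<in> carrier (K[X])" by (simp add: monic_in_def)
      have "degree D \<le> degree (prod_poly Irr)"
        using pdivides_imp_degree_le[OF subring_K Dc prod_poly_closed prod_poly_ne]
          pdivides_iff_shell[OF subfield_K Dc prod_poly_closed] D by simp
      then show "length D \<le> length (prod_poly Irr)"
        using prod_poly_ne[OF subset_refl] by (cases D; cases "prod_poly Irr") auto
    qed
  qed
  have "2 ^ card Irr = card (Pow Irr)"
    using finite_Irr by (simp add: card_Pow)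
  also have "\<dots> \<le> card ?D"
  proof (rule card_inj_on_le[OF _ _ fin])
    have sub: "S \<subseteq> T" if "S \<subseteq> Irr" "T \<subseteq> Irr" "prod_poly S = prod_poly T" for S T
    proof
      fix P assume P: "P \<in> S"
      have finS: "finite S" "finite T" using that finite_Irr by (auto intro: finite_subset)
      have "prod_poly S = P \<otimes>\<^bsub>K[X]\<^esub> prod_poly (S - {P})"
        using prod_poly_insert[of "S - {P}" P] P that finS by (simp add: insert_absorb)
      then have "P divides\<^bsub>K[X]\<^esub> prod_poly T"
        using that prod_poly_closed[of "S - {P}"] divides_mult_right by (metis Diff_subset subset_trans)
      then show "P \<in> T"
        using Irr_divides_prod_poly[of T P] finS P that by blast
    qed
    show "inj_on prod_poly (Pow Irr)"
    proof (rule inj_onI)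
      fix S T assume "S \<in> Pow Irr" "T \<in> Pow Irr" "prod_poly S = prod_poly T"
      then show "S = T" using sub[of S T] sub[of T S] by simp
    qed
    show "prod_poly ` Pow Irr \<subseteq> ?D"
    proof safe
      fix S assume S: "S \<subseteq> Irr"
      have finS: "finite S" using S finite_Irr by (rule finite_subset)
      show "monic_in R K (prod_poly S)"
        using prod_poly_props[OF finS S] by blast
      have "prod_poly (S \<union> (Irr - S)) = prod_poly S \<otimes>\<^bsub>K[X]\<^esub> prod_poly (Irr - S)"
        using S finS finite_Irr IrrD(1) by (intro UP.finprod_Un_disjoint) auto
      moreover have "S \<union> (Irr - S) = Irr" using S by blast
      ultimately show "prod_poly S divides\<^bsub>K[X]\<^esub> prod_poly Irr"
        using prod_poly_closed[of "Irr - S"] divides_mult_right by (metis Diff_subset)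
    qed
  qed
  finally show ?thesis by (simp add: W_poly_def)
qed

text \<open>Chinese remainder theorem: pairs of units modulo P and modulo G give units modulo the
  product, and modulo P there is a field with at least \<open>Q ^ degree P\<close> elements, all but
  one of them units.\<close>

lemma phi_poly_mult_ge:
  assumes P: "P \<in> Irr" and G: "G \<in> carrier (K[X])" "G \<noteq> []" and ndvd: "\<not> P divides\<^bsub>K[X]\<^esub> G"
  shows "(Q ^ degree P - 1) * phi_poly R K G \<le> phi_poly R K (P \<otimes>\<^bsub>K[X]\<^esub> G)"
proof -
  note Pc = IrrD(1)[OF P]
  let ?I = "PIdl\<^bsub>K[X]\<^esub> P" and ?J = "PIdl\<^bsub>K[X]\<^esub> G"
  have idI: "ideal ?I (K[X])" and idJ: "ideal ?J (K[X])"
    using Pc G UP.cgenideal_ideal by auto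
  have PGc: "P \<otimes>\<^bsub>K[X]\<^esub> G \<in> carrier (K[X])" using Pc G by simp
  have PGne: "P \<otimes>\<^bsub>K[X]\<^esub> G \<noteq> []"
    using UP.integral_iff[OF Pc G(1)] IrrD(2)[OF P] G by (simp add: univ_poly_zero)
  \<comment> \<open>The ideal of P is maximal and does not contain G, so the two ideals are
    comaximal.\<close>
  have sum: "?I <+>\<^bsub>K[X]\<^esub> ?J = carrier (K[X])"
  proof -
    interpret I: maximalideal ?I "K[X]"
      by (rule UP.irreducible_imp_maximalideal[OF Pc IrrD(3)[OF P]])
    have idS: "ideal (?I <+>\<^bsub>K[X]\<^esub> ?J) (K[X])"
      by (rule UP.add_ideals[OF idI idJ])
    have zI: "\<zero>\<^bsub>K[X]\<^esub> \<in> ?I" and zJ: "\<zero>\<^bsub>K[X]\<^esub> \<in> ?J"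
      using additive_subgroup.zero_closed[OF ideal.axioms(1)] idI idJ by blast+
    have "?I \<subseteq> ?I <+>\<^bsub>K[X]\<^esub> ?J"
    proof
      fix a assume a: "a \<in> ?I"
      then have "a = a \<oplus>\<^bsub>K[X]\<^esub> \<zero>\<^bsub>K[X]\<^esub>" using ideal.Icarr[OF idI] by simp
      then show "a \<in> ?I <+>\<^bsub>K[X]\<^esub> ?J" using a zJ unfolding set_add_def' by blast
    qed
    moreover have "?I <+>\<^bsub>K[X]\<^esub> ?J \<noteq> ?I"
    proof
      assume e: "?I <+>\<^bsub>K[X]\<^esub> ?J = ?I"
      have "G = \<zero>\<^bsub>K[X]\<^esub> \<oplus>\<^bsub>K[X]\<^esub> G" using G by simp
      then have "G \<in> ?I <+>\<^bsub>K[X]\<^esub> ?J"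
        using zI UP.cgenideal_self[OF G(1)] unfolding set_add_def' by blast
      then have "?J \<subseteq> ?I" using e UP.cgenideal_minimal[OF idI] by simp
      then show False
        using UP.to_contain_is_to_divide[OF Pc G(1)] ndvd by simp
    qed
    ultimately show ?thesis
      using I.I_maximal[OF idS] ideal.Icarr[OF idS] by blast
  qed
  \<comment> \<open>A common multiple of P and G is b G with P dividing b, since P is prime and does
    not divide G.\<close>
  have inter: "?I \<inter> ?J = PIdl\<^bsub>K[X]\<^esub> (P \<otimes>\<^bsub>K[X]\<^esub> G)"
  proof
    show "PIdl\<^bsub>K[X]\<^esub> (P \<otimes>\<^bsub>K[X]\<^esub> G) \<subseteq> ?I \<inter> ?J"
    proof -
      have "P divides\<^bsub>K[X]\<^esub> P \<otimes>\<^bsub>K[X]\<^esub> G" "G divides\<^bsub>K[X]\<^esub> P \<otimes>\<^bsub>K[X]\<^esub> G"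
        using Pc G divides_mult_right[of G P] divides_mult_right[of P G] by (simp_all add: UP.m_comm)
      then show ?thesis
        using UP.to_contain_is_to_divide[OF Pc PGc] UP.to_contain_is_to_divide[OF G(1) PGc] by blast
    qed
    show "?I \<inter> ?J \<subseteq> PIdl\<^bsub>K[X]\<^esub> (P \<otimes>\<^bsub>K[X]\<^esub> G)"
    proof
      fix x assume "x \<in> ?I \<inter> ?J"
      then obtain a b where ab: "a \<in> carrier (K[X])" "b \<in> carrier (K[X])"
        "x = a \<otimes>\<^bsub>K[X]\<^esub> P" "x = b \<otimes>\<^bsub>K[X]\<^esub> G"
        by (auto simp: cgenideal_def)
      have "b \<otimes>\<^bsub>K[X]\<^esub> G = P \<otimes>\<^bsub>K[X]\<^esub> a"
        using ab Pc by (simp add: UP.m_comm)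
      then have "P divides\<^bsub>K[X]\<^esub> b \<otimes>\<^bsub>K[X]\<^esub> G"
        using ab divides_mult_right[of a P] by simp
      then have "P divides\<^bsub>K[X]\<^esub> b"
        using prime_divides_mult[OF P ab(2) G(1)] ndvd by blast
      then obtain c where c: "c \<in> carrier (K[X])" "b = P \<otimes>\<^bsub>K[X]\<^esub> c"
        by (auto simp: factor_def)
      have "x = c \<otimes>\<^bsub>K[X]\<^esub> (P \<otimes>\<^bsub>K[X]\<^esub> G)"
        using ab(4) c Pc G by (simp add: UP.m_ac)
      then show "x \<in> PIdl\<^bsub>K[X]\<^esub> (P \<otimes>\<^bsub>K[X]\<^esub> G)"
        using c by (auto simp: cgenideal_def)
    qed
  qed
  let ?A = "Rupt K (P \<otimes>\<^bsub>K[X]\<^esub> G)" and ?B = "RDirProd (Rupt K P) (Rupt K G)"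
  obtain h where h: "h \<in> ring_iso ?A ?B"
    using UP.chinese_remainder_simple[OF idI idJ sum] unfolding inter is_ring_iso_def rupture_def by blast
  have rings: "ring (Rupt K P)" "ring (Rupt K G)" "ring ?A"
    using ideal.quotient_is_ring UP.cgenideal_ideal Pc G PGc unfolding rupture_def by blast+
  have "card (Units ?B) \<le> card (Units ?A)"
    using finite_rupture[OF PGc PGne] rings h
    by (intro card_Units_le_of_ring_iso[of ?A ?B h] RDirProd_ring) auto
  moreover have "card (Units (Rupt K P) \<times> Units (Rupt K G)) \<le> card (Units ?B)"
  proof (rule card_mono[OF _ Units_RDirProd])
    have "Units ?B \<subseteq> carrier (Rupt K P) \<times> carrier (Rupt K G)"
      by (auto simp: Units_def RDirProd_carrier)
    then show "finite (Units ?B)"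
      using finite_rupture[OF Pc IrrD(2)[OF P]] finite_rupture[OF G] by (auto intro: finite_subset)
  qed
  moreover have "Q ^ degree P - 1 \<le> card (Units (Rupt K P))"
  proof -
    interpret RP: field "Rupt K P"
      using rupture_is_field_iff_pirreducible[OF subfield_K Pc] IrrD(3)[OF P] by blast
    have "card (Units (Rupt K P)) = card (carrier (Rupt K P)) - 1"
      using finite_rupture[OF Pc IrrD(2)[OF P]] by (simp add: RP.field_Units)
    then show ?thesis
      using card_rupture[OF Pc IrrD(2)[OF P]] by simp
  qed
  ultimately show ?thesis
    unfolding phi_poly_def card_cartesian_product
    by (meson le_trans mult_le_mono1)
qed

lemma phi_poly_prod_ge:
  assumes "finite S" "S \<subseteq> Irr"
  shows "(\<Prod>P\<in>S. Q ^ degree P - 1) \<le> phi_poly R K (prod_poly S)"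
  using assms
proof (induction S rule: finite_induct)
  case empty
  \<comment> \<open>The quotient by the unit ideal is the zero ring; its only element is a unit,
    which matches the empty product 1.\<close>
  have one: "\<one>\<^bsub>K[X]\<^esub> \<in> carrier (K[X])" "\<one>\<^bsub>K[X]\<^esub> \<noteq> []" by (simp, simp add: univ_poly_one)
  interpret RO: ring "Rupt K \<one>\<^bsub>K[X]\<^esub>"
    using ideal.quotient_is_ring[OF UP.cgenideal_ideal[OF one(1)]] by (simp add: rupture_def)
  have "finite (Units (Rupt K \<one>\<^bsub>K[X]\<^esub>))"
    using finite_rupture[OF one] by (rule rev_finite_subset) (auto simp: Units_def)
  then have "card (Units (Rupt K \<one>\<^bsub>K[X]\<^esub>)) > 0"
    using RO.Units_one_closed by (auto simp: card_gt_0_iff)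
  then show ?case by (simp add: phi_poly_def)
next
  case (insert P S)
  have "\<not> P divides\<^bsub>K[X]\<^esub> prod_poly S"
    using Irr_divides_prod_poly[of S P] insert by blast
  then have "(Q ^ degree P - 1) * phi_poly R K (prod_poly S) \<le> phi_poly R K (P \<otimes>\<^bsub>K[X]\<^esub> prod_poly S)"
    using insert.prems by (intro phi_poly_mult_ge prod_poly_closed prod_poly_ne) auto
  moreover have "(Q ^ degree P - 1) * (\<Prod>P\<in>S. Q ^ degree P - 1) \<le> (Q ^ degree P - 1) * phi_poly R K (prod_poly S)"
    using insert by (intro mult_le_mono2) auto
  ultimately have "(Q ^ degree P - 1) * (\<Prod>P\<in>S. Q ^ degree P - 1) \<le> phi_poly R K (P \<otimes>\<^bsub>K[X]\<^esub> prod_poly S)"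
    by (rule order_trans[rotated])
  then show ?case
    using insert.hyps insert.prems prod_poly_insert[of S P] by simp
qed

text \<open>The twos give 2 to the power \<open>card Irr\<close>, at most the number of monic
  divisors. The other factors have a common denominator that matches because degrees add up over
  \<open>Irr\<close>, and their numerator is at most the number of units.\<close>

lemma phi_W_ge:
  "(\<Prod>P\<in>Irr. 2 * (1 - 1 / real (Q ^ degree P)))
    \<le> real (W_poly R K (sqfree_part R K F)) *
      (real (phi_poly R K (sqfree_part R K F)) / real Q ^ degree (sqfree_part R K F))"
proof -
  have F': "sqfree_part R K F = prod_poly Irr"
    by (simp add: sqfree_part_def Irr_def)
  have Q0: "real Q > 0" using Q_gt_1 by simp
  have "(\<Prod>P\<in>Irr. 2 * (1 - 1 / real (Q ^ degree P))) = 2 ^ card Irr * (\<Prod>P\<in>Irr. 1 - 1 / real (Q ^ degree P))"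
    by (simp only: prod.distrib prod_constant)
  also have "(\<Prod>P\<in>Irr. 1 - 1 / real (Q ^ degree P)) = (\<Prod>P\<in>Irr. real (Q ^ degree P - 1) / real (Q ^ degree P))"
  proof (rule prod.cong[OF refl])
    fix P
    have "Q ^ degree P \<ge> 1" using Q_gt_1 by simp
    then have "real (Q ^ degree P - 1) = real (Q ^ degree P) - 1" "real (Q ^ degree P) \<noteq> 0"
      by (simp_all only: of_nat_diff of_nat_1 of_nat_eq_0_iff)
    then show "1 - 1 / real (Q ^ degree P) = real (Q ^ degree P - 1) / real (Q ^ degree P)"
      by (simp only: diff_divide_distrib divide_self not_False_eq_True)
  qed
  also have "\<dots> = real (\<Prod>P\<in>Irr. Q ^ degree P - 1) / real Q ^ degree (prod_poly Irr)"
  proof -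
    have "(\<Prod>P\<in>Irr. real (Q ^ degree P)) = real Q ^ degree (prod_poly Irr)"
      using prod_poly_props[OF finite_Irr subset_refl] by (simp add: power_sum)
    then show ?thesis by (simp add: prod_dividef del: of_nat_power)
  qed
  also have "2 ^ card Irr * \<dots> \<le> real (W_poly R K (prod_poly Irr)) *
      (real (phi_poly R K (prod_poly Irr)) / real Q ^ degree (prod_poly Irr))"
  proof (rule mult_mono)
    have "real (2 ^ card Irr) \<le> real (W_poly R K (prod_poly Irr))"
      using W_poly_ge by (simp only: of_nat_le_iff)
    then show "2 ^ card Irr \<le> real (W_poly R K (prod_poly Irr))" by simp
    show "real (\<Prod>P\<in>Irr. Q ^ degree P - 1) / real Q ^ degree (prod_poly Irr)
        \<le> real (phi_poly R K (prod_poly Irr)) / real Q ^ degree (prod_poly Irr)"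
      using phi_poly_prod_ge[OF finite_Irr subset_refl] Q0
      by (intro divide_right_mono) (simp_all only: of_nat_le_iff zero_le_power less_imp_le)
  qed (use Q0 in \<open>simp_all add: prod_nonneg\<close>)
  finally show ?thesis by (simp only: F')
qed

end

section \<open>Completely normal elements\<close>

text \<open>Here p is the characteristic: it kills the additive group and hence each quotient by
  \<open>H P\<close>, while the constant comes from the index bound
  \<open>Q ^ degree P\<close>.\<close>

lemma (in frobenius_action) fourier_bound_independent:
  assumes p: "prime (p::nat)" and char: "[p] \<cdot> \<one> = \<zero>"
  shows "fourier_bound (add_monoid R) (\<lambda>x. of_bool (independent K (conj_list x)))
    (\<Prod>P\<in>Irr. 2 * (1 - 1 / real (Q ^ degree P)))"
proof -
  have "fourier_bound (add_monoid R) (\<lambda>x. \<Prod>P\<in>Irr. of_bool (x \<notin> H P))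
      (\<Prod>P\<in>Irr. 2 * (1 - 1 / real (Q ^ degree P)))"
  proof (rule fourier_bound_prod[OF finite_Irr])
    fix P assume P: "P \<in> Irr"
    show "fourier_bound (add_monoid R) (\<lambda>x. of_bool (x \<notin> H P)) (2 * (1 - 1 / real (Q ^ degree P)))"
    proof (rule comm_group.fourier_bound_compl_subgroup[OF a_comm_group _ p subgroup_H[OF P]])
      show "finite (carrier (add_monoid R))" using finite_R by simp
      show "order (add_monoid R) \<le> card (H P) * Q ^ degree P"
        using order_le_card_H[OF P] by (simp add: order_def)
      fix y assume "y \<in> carrier (add_monoid R)"
      then have "[p] \<cdot> y = \<zero>"
        using add_pow_ldistr[of \<one> y p] char by simp
      then show "y [^]\<^bsub>add_monoid R\<^esub> p \<in> H P"
        using subgroup.one_closed[OF subgroup_H[OF P]] by (simp add: add_pow_def)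
    qed
  qed
  then show ?thesis
  proof (rule fourier_bound.weaken)
    fix x assume "x \<in> carrier (add_monoid R)"
    then show "of_bool (independent K (conj_list x)) = (\<Prod>P\<in>Irr. of_bool (x \<notin> H P) :: complex)"
      by (simp only: independent_conj_list_iff partial_object.select_convs of_bool_ball_eq_prod[OF finite_Irr])
  qed simp
qed

context finite_field
begin

lemma frobenius_action_GFsub:
  assumes l: "l dvd n"
  shows "frobenius_action R (GFsub R q l) (q ^ l) (n div l)"
proof (rule frobenius_action.intro[OF field_axioms], rule frobenius_action_axioms.intro)
  have "GFsub R q l \<subseteq> carrier R" by (auto simp: GFsub_eq[OF l])
  then show "finite (GFsub R q l)" using finite_carrier by (rule finite_subset)
  show "0 < n div l" using l n_pos by (auto elim!: dvdE)
  show "order R = (q ^ l) ^ (n div l)"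
    using l by (simp add: order_eq flip: power_mult)
qed (use l in \<open>auto simp: subfield_GFsub card_GFsub frobenius_add\<close>)

lemma normal_over_iff_independent:
  assumes l: "l dvd n"
  shows "normal_over R q n l x \<longleftrightarrow> independent (GFsub R q l) (conjugates R q n l x)"
proof -
  interpret fa: frobenius_action R "GFsub R q l" "q ^ l" "n div l"
    by (rule frobenius_action_GFsub[OF l])
  show ?thesis
    unfolding normal_over_def
    using fa.independent_imp_Span_eq_carrier[of "conjugates R q n l x"] by (auto simp: conjugates_def)
qed

lemma fourier_bound_normal_over:
  assumes l: "l dvd n"
  shows "fourier_bound (add_monoid R) (\<lambda>x. of_bool (normal_over R q n l x))
    (real (W_poly R (GFsub R q l) (F_sqfree R q n l)) * theta_l R q n l)"
proof -
  interpret fa: frobenius_action R "GFsub R q l" "q ^ l" "n div l"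
    by (rule frobenius_action_GFsub[OF l])
  have F: "F_sqfree R q n l = sqfree_part R (GFsub R q l) fa.F"
    by (simp add: F_sqfree_def fa.F_def)
  have th: "theta_l R q n l = real (phi_poly R (GFsub R q l) (sqfree_part R (GFsub R q l) fa.F))
      / real (q ^ l) ^ degree (sqfree_part R (GFsub R q l) fa.F)"
    by (simp add: theta_l_def F power_mult)
  have conj: "conjugates R q n l x = fa.conj_list x" for x
    by (simp add: conjugates_def fa.conj_list_def power_mult)
  obtain p e where p: "prime p" "q = p ^ e" "[p] \<cdot> \<one> = \<zero>"
    by (rule obtains_char)
  show ?thesis
    unfolding th F
    by (rule fourier_bound.weaken[OF fa.fourier_bound_independent[OF p(1,3)] _ fa.phi_W_ge])
       (simp add: normal_over_iff_independent[OF l] conj)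
qed

lemma normal_over_n_iff:
  assumes "x \<in> carrier R"
  shows "normal_over R q n n x \<longleftrightarrow> x \<noteq> \<zero>"
proof -
  have "conjugates R q n n x = [x]"
    using n_pos assms by (simp add: conjugates_def)
  moreover have "independent K [x] \<longleftrightarrow> x \<noteq> \<zero>" for K
    using assms independent_backwards(1)[of K x "[]"] li_Cons[of x K "[]"] by auto
  ultimately show ?thesis
    by (simp add: normal_over_iff_independent)
qed

text \<open>Over the whole field x is its only conjugate, so the divisor n contributes just x
  \<noteq> \<zero>. The counts thereby become sums over nonzero elements, where additive and
  multiplicative characters can be paired.\<close>

lemma completely_normal_iff:
  assumes "x \<in> carrier R"
  shows "completely_normal R q n x \<longleftrightarrow> x \<noteq> \<zero> \<and> (\<forall>l\<in>proper_divisors n. normal_over R q n l x)"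
proof -
  have "l dvd n \<longleftrightarrow> l = n \<or> l \<in> proper_divisors n" for l
    using n_pos dvd_imp_le by (fastforce simp: proper_divisors_def)
  then show ?thesis
    using normal_over_n_iff[OF assms] by (auto simp: completely_normal_def)
qed

lemma completely_normal_free_bound:
  assumes r: "r dvd q ^ n - 1"
  shows "\<bar>real (CN_free R q n r) - theta r * real (CN R q n)\<bar>
    \<le> sqrt (real (q ^ n)) * (real (W r) * theta r)
      * (\<Prod>l\<in>proper_divisors n. real (W_poly R (GFsub R q l) (F_sqfree R q n l)) * theta_l R q n l)"
proof -
  let ?U = "carrier R - {\<zero>}"
  let ?f = "\<lambda>x. of_bool (r_free R r x) :: complex"
  let ?g = "\<lambda>x. \<Prod>l\<in>proper_divisors n. of_bool (normal_over R q n l x) :: complex"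
  have fin: "finite ?U" using finite_carrier by simp
  have finpd: "finite (proper_divisors n)" by (simp add: proper_divisors_def)
  have "q ^ n - 1 > 0" using one_less_power[OF q_gt_1 n_pos] by simp
  then have r0: "r > 0" using r by (rule dvd_pos_nat)
  have f: "fourier_bound (Multiplicative_Group.mult_of R) ?f (real (W r) * theta r)"
    by (rule fourier_bound.weaken[OF fourier_bound_r_free[OF finite_carrier r0] refl W_theta_ge[OF r0]])
  have g: "fourier_bound (add_monoid R) ?g
      (\<Prod>l\<in>proper_divisors n. real (W_poly R (GFsub R q l) (F_sqfree R q n l)) * theta_l R q n l)"
    by (rule fourier_bound_prod[OF finpd], rule fourier_bound_normal_over) (simp add: proper_divisors_def)
  \<comment> \<open>Because the mean is exactly \<theta>(r), the centred correlation equals the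
    difference to be bounded, without an error term.\<close>
  have mean: "(\<Sum>y\<in>?U. ?f y) / of_nat (card ?U) = of_real (theta r)"
  proof -
    have "\<one> \<in> ?U" by simp
    then have "card ?U > 0" using fin card_gt_0_iff by blast
    moreover have "(\<Sum>y\<in>?U. ?f y) = of_nat (card {x \<in> ?U. r_free R r x})"
      using fin by (simp add: Int_def)
    moreover have "real (card {x \<in> ?U. r_free R r x}) = theta r * real (card ?U)"
      using card_r_free[OF finite_carrier, of r] r by (simp add: order_eq)
    ultimately show ?thesis
      by (metis (no_types, lifting) nonzero_mult_div_cancel_right of_nat_0_eq_iff of_real_mult of_real_of_nat_eq less_irrefl)
  qed
  have cn: "completely_normal R q n x \<longleftrightarrow> (\<forall>l\<in>proper_divisors n. normal_over R q n l x)" if "x \<in> ?U" for x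
    using completely_normal_iff[of x] that by simp
  have gcn: "?g x = of_bool (completely_normal R q n x)" if "x \<in> ?U" for x
    by (simp only: of_bool_ball_eq_prod[OF finpd, symmetric] cn[OF that])
  have "CN R q n = card {x \<in> ?U. completely_normal R q n x}"
    unfolding CN_def by (rule arg_cong[of _ _ card]) (auto simp: completely_normal_iff)
  then have CN: "of_nat (CN R q n) = (\<Sum>x\<in>?U. ?g x)"
    using fin by (simp add: gcn Int_def)
  have "CN_free R q n r = card {x \<in> ?U. r_free R r x \<and> completely_normal R q n x}"
    unfolding CN_free_def by (rule arg_cong[of _ _ card]) (auto simp: completely_normal_iff)
  then have CNf: "of_nat (CN_free R q n r) = (\<Sum>x\<in>?U. ?f x * ?g x)"
    using fin by (simp add: gcn Int_def flip: of_bool_conj)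
  have "(\<Sum>x\<in>?U. (?f x - (\<Sum>y\<in>?U. ?f y) / of_nat (card ?U)) * ?g x)
      = of_real (real (CN_free R q n r) - theta r * real (CN R q n))"
    unfolding mean by (simp add: left_diff_distrib sum_subtractf CNf CN sum_distrib_left)
  then show ?thesis
    using fourier_bound_correlation[OF finite_carrier f g] by (simp only: norm_of_real order_eq)
qed

end

theorem theorem4:
  fixes R :: "('a, 'b) ring_scheme" and q n r :: nat
  assumes "primepow q" and "n > 0"
    and "field R" and "order R = q ^ n"
    and "squarefree r" and "r dvd q ^ n - 1"
  shows "\<bar>real (CN_free R q n r) - theta r * real (CN R q n)\<bar>
    \<le> real q powr (real n / 2) * real (W r)
      * (\<Prod>l\<in>proper_divisors n. real (W_poly R (GFsub R q l) (F_sqfree R q n l)))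
      * theta r * theta_q R q n"
proof -
  interpret field R by fact
  interpret finite_field R q n
    using assms by unfold_locales
  have "real q powr (real n / 2) = (real q powr real n) powr (1 / 2)"
    by (simp add: powr_powr)
  also have "\<dots> = sqrt (real (q ^ n))"
    using q_gt_1 by (simp add: powr_realpow powr_half_sqrt)
  finally show ?thesis
    using completely_normal_free_bound[OF assms(6)] by (simp add: theta_q_def prod.distrib mult_ac)
qed

end
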